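(* Let $I$ be an institution with a skolemization $\langle I,S,(\mathcal I_\Sigma)_{\Sigma\in|\mathit{Sig}^I|},(\tau_\Sigma)_{\Sigma\in|\mathit{Sig}^I|}\rangle$, where $S(\Sigma,M)=\langle(\Sigma_S,S_\Sigma),M_{S\Sigma}\rangle$. Let $J$ be an institution and $\langle\phi,\alpha,\beta\rangle:J\to I$ an institution morphism such that: (1) $\phi:\mathit{Sig}^J\to\mathit{Sig}^I$ is fully faithful; (2) for each $\Sigma\in|\mathit{Sig}^J|$ there is $\tilde\Sigma\in|\mathit{Sig}^J|$ and an isomorphism $i_{\phi\Sigma}:\phi(\tilde\Sigma)\to(\phi\Sigma)_S$ in $\mathit{Sig}^I$; (3) each $\beta_\Sigma:\mathit{Mod}^J(\Sigma)\to\mathit{Mod}^I(\phi\Sigma)$ is an isomorphism of categories; (4) each $\alpha_\Sigma$ is semantically surjective, i.e. for every $\varphi\in\mathit{Sen}^J(\Sigma)$ there is $\psi\in\alpha_\Sigma[\mathit{Sen}^I(\phi\Sigma)]$ with $\varphi^*=\psi^*$. Then $J$ has a skolemization $\langle J,S',(\mathcal I'_\Sigma)_{\Sigma\in|\mathit{Sig}^J|},(\tau'_\Sigma)_{\Sigma\in|\mathit{Sig}^J|}\rangle$ in which, for each $\Sigma$: the skolem signature of $\Sigma$ is $\tilde\Sigma$; $\tau'_\Sigma:\Sigma\to\tilde\Sigma$ is the unique arrow with $\phi(\tau'_\Sigma)=i_{\phi\Sigma}^{-1}\circ\tau_{\phi\Sigma}$; and if $\mathcal I_{\phi\Sigma}=\langle\mathcal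 U,\mathcal E\rangle$ then $\mathcal I'_\Sigma=\langle\mathcal U',\mathcal E'\rangle$, where $\mathcal U'$ and $\mathcal E'$ are the images of $\mathcal U$ and $\mathcal E$ under the functor $\beta_{\tilde\Sigma}^{-1}\circ\mathit{Mod}^I(i_{\phi\Sigma}):\mathit{Mod}^I((\phi\Sigma)_S)\to\mathit{Mod}^J(\tilde\Sigma)$.
   Context: An institution $\langle\mathit{Sig},\mathit{Sen},\mathit{Mod},\models\rangle$: a category $\mathit{Sig}$, functors $\mathit{Sen}:\mathit{Sig}\to\mathbf{Set}$, $\mathit{Mod}:\mathit{Sig}^{op}\to\mathbf{Cat}$, and relations $\models_\Sigma\subseteq|\mathit{Mod}(\Sigma)|\times\mathit{Sen}(\Sigma)$ with $M'\models_{\Sigma'}\mathit{Sen}(h)(\phi)$ iff $\mathit{Mod}(h)(M')\models_\Sigma\phi$ for all $h:\Sigma\to\Sigma'$. Write $M\restriction_h=\mathit{Mod}(h)(M)$; for a model $M$, $M^*=\{\varphi: M\models\varphi\}$; for a sentence $\varphi$, $\varphi^*$ is the class of models satisfying it. An institution morphism $\langle\phi,\alpha,\beta\rangle:J\to I$: a functor $\phi:\mathit{Sig}^J\to\mathit{Sig}^I$, natural transformations $\alpha:\mathit{Sen}^I\circ\phi\Rightarrow\mathit{Sen}^J$, $\beta:\mathit{Mod}^J\Rightarrow\mathit{Mod}^I\circ\phi^{op}$, with $m\models^J_\Sigma\alpha_\Sigma(\psi)$ iff $\beta_\Sigma(m)\models^I_{\phi\Sigma}\psi$. The Grothendieck category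 $\mathit{Mod}^\sharp$ has objects $(\Sigma,M)$ with $M\in|\mathit{Mod}(\Sigma)|$ and arrows $(f,u):(\Sigma,M)\to(\Sigma',N)$ with $f:\Sigma\to\Sigma'$ and $u:M\to N\restriction_f$ in $\mathit{Mod}(\Sigma)$, composed by $(g,v)\circ(f,u)=(g\circ f,\mathit{Mod}(f)(v)\circ u)$. $\mathbb{P}res$ is the category of presentations $(\Sigma,E)$, $E\subseteq\mathit{Sen}(\Sigma)$, with arrows $f:\Sigma\to\Sigma'$ such that $\mathit{Sen}(f)(E)\subseteq E'$; $\mathit{Mod}^{\mathbb{P}res}(\Sigma,E)$ is the full subcategory of $\mathit{Mod}(\Sigma)$ of models satisfying all of $E$, with reducts inherited from $\mathit{Mod}$. An inclusion system on a category $\mathcal C$ is a pair $\langle\mathcal U,\mathcal E\rangle$ of broad subcategories of $\mathcal C$ such that $\mathcal U$ is a partial order and every arrow of $\mathcal C$ factors uniquely as an arrow of $\mathcal E$ followed by an arrow of $\mathcal U$; arrows of $\mathcal U$ are written $M\hookrightarrow N$. A skolemization of an institution $I$ is a tuple $\langle I,S,(\mathcal I_\Sigma)_{\Sigma},(\tau_\Sigma)_{\Sigma}\rangle$ where: $S:\mathit{Mod}^\sharp\to(\mathit{Mod}^{\mathbb{P}res})^\sharp$ is a functor sending $(\Sigma,M)$ to $((\Sigma_S,S_\Sigma),M_{S\Sigma})$ (the presentation $(\Sigma_S,S_\Sigma)$ depending only on $\Sigma$); for each $\Sigma$, $\tau_\Sigma:\Sigma\to\Sigma_S$ is an arrow of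 $\mathit{Sig}$ with $M_{S\Sigma}\restriction_{\tau_\Sigma}=M$ for all $M\in|\mathit{Mod}(\Sigma)|$; a $\Sigma_S$-model $M'$ is called a skolemization of the $\Sigma$-model $M$ if $M'\restriction_{\tau_\Sigma}=M$ and $M'\models S_\Sigma$; and $\mathcal I_\Sigma$ is an inclusion system on $\mathit{Mod}(\Sigma_S)$ such that whenever $M',N'$ are skolemizations of $M,N$ respectively and $M'\hookrightarrow N'$, then $M^*=N^*$. *)

theory Defs
  imports Main "HOL-Library.FuncSet"
begin

section \<open>Categories and functors\<close>

record ('o, 'a) cat =
  Obj :: "'o set"
  Arr :: "'a set"
  Src :: "'a \<Rightarrow> 'o"
  Tgt :: "'a \<Rightarrow> 'o"
  Idn :: "'o \<Rightarrow> 'a"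
  Cmp :: "'a \<Rightarrow> 'a \<Rightarrow> 'a"

text \<open>\<open>Cmp C g f\<close> is \<open>g \<circ> f\<close>. All functions are only constrained on \<open>Obj C\<close>, \<open>Arr C\<close> and on
  composable pairs.\<close>

locale category =
  fixes C :: "('o, 'a) cat"
  assumes src_obj: "f \<in> Arr C \<Longrightarrow> Src C f \<in> Obj C"
    and tgt_obj: "f \<in> Arr C \<Longrightarrow> Tgt C f \<in> Obj C"
    and idn_arr: "x \<in> Obj C \<Longrightarrow> Idn C x \<in> Arr C"
    and src_idn: "x \<in> Obj C \<Longrightarrow> Src C (Idn C x) = x"
    and tgt_idn: "x \<in> Obj C \<Longrightarrow> Tgt C (Idn C x) = x"
    and cmp_arr: "\<lbrakk>f \<in> Arr C; g \<in> Arr C; Tgt C f = Src C g\<rbrakk> \<Longrightarrow> Cmp C g f \<in> Arr C"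
    and src_cmp: "\<lbrakk>f \<in> Arr C; g \<in> Arr C; Tgt C f = Src C g\<rbrakk> \<Longrightarrow> Src C (Cmp C g f) = Src C f"
    and tgt_cmp: "\<lbrakk>f \<in> Arr C; g \<in> Arr C; Tgt C f = Src C g\<rbrakk> \<Longrightarrow> Tgt C (Cmp C g f) = Tgt C g"
    and cmp_idn_right: "f \<in> Arr C \<Longrightarrow> Cmp C f (Idn C (Src C f)) = f"
    and cmp_idn_left: "f \<in> Arr C \<Longrightarrow> Cmp C (Idn C (Tgt C f)) f = f"
    and cmp_assoc: "\<lbrakk>f \<in> Arr C; g \<in> Arr C; h \<in> Arr C; Tgt C f = Src C g; Tgt C g = Src C h\<rbrakk>
        \<Longrightarrow> Cmp C h (Cmp C g f) = Cmp C (Cmp C h g) f"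

definition hom_set :: "('o, 'a) cat \<Rightarrow> 'o \<Rightarrow> 'o \<Rightarrow> 'a set" where
  "hom_set C x y = {f \<in> Arr C. Src C f = x \<and> Tgt C f = y}"

definition inverse_arrows :: "('o, 'a) cat \<Rightarrow> 'a \<Rightarrow> 'a \<Rightarrow> bool" where
  "inverse_arrows C f g \<longleftrightarrow>
     f \<in> Arr C \<and> g \<in> hom_set C (Tgt C f) (Src C f) \<and>
     Cmp C g f = Idn C (Src C f) \<and> Cmp C f g = Idn C (Tgt C f)"

definition iso_arrow :: "('o, 'a) cat \<Rightarrow> 'a \<Rightarrow> bool" where
  "iso_arrow C f \<longleftrightarrow> (\<exists>g. inverse_arrows C f g)"

definition inv_arrow :: "('o, 'a) cat \<Rightarrow> 'a \<Rightarrow> 'a" where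
  "inv_arrow C f = (THE g. inverse_arrows C f g)"

definition full_subcat :: "('o, 'a) cat \<Rightarrow> ('o \<Rightarrow> bool) \<Rightarrow> ('o, 'a) cat" where
  "full_subcat C P =
     C\<lparr>Obj := {x \<in> Obj C. P x}, Arr := {f \<in> Arr C. P (Src C f) \<and> P (Tgt C f)}\<rparr>"

record ('o1, 'a1, 'o2, 'a2) fnctr =
  FOb :: "'o1 \<Rightarrow> 'o2"
  FAr :: "'a1 \<Rightarrow> 'a2"

locale is_functor = src: category C + tgt: category D
  for C :: "('o1, 'a1) cat" and D :: "('o2, 'a2) cat" +
  fixes F :: "('o1, 'a1, 'o2, 'a2) fnctr"
  assumes ob: "x \<in> Obj C \<Longrightarrow> FOb F x \<in> Obj D"
    and ar: "f \<in> Arr C \<Longrightarrow> FAr F f \<in> Arr D"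
    and src: "f \<in> Arr C \<Longrightarrow> Src D (FAr F f) = FOb F (Src C f)"
    and tgt: "f \<in> Arr C \<Longrightarrow> Tgt D (FAr F f) = FOb F (Tgt C f)"
    and idn: "x \<in> Obj C \<Longrightarrow> FAr F (Idn C x) = Idn D (FOb F x)"
    and cmp: "\<lbrakk>f \<in> Arr C; g \<in> Arr C; Tgt C f = Src C g\<rbrakk>
        \<Longrightarrow> FAr F (Cmp C g f) = Cmp D (FAr F g) (FAr F f)"

definition functor_comp ::
  "('o2, 'a2, 'o3, 'a3) fnctr \<Rightarrow> ('o1, 'a1, 'o2, 'a2) fnctr \<Rightarrow> ('o1, 'a1, 'o3, 'a3) fnctr" where
  "functor_comp G F = \<lparr>FOb = FOb G \<circ> FOb F, FAr = FAr G \<circ> FAr F\<rparr>"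

definition fully_faithful ::
  "('o1, 'a1) cat \<Rightarrow> ('o2, 'a2) cat \<Rightarrow> ('o1, 'a1, 'o2, 'a2) fnctr \<Rightarrow> bool" where
  "fully_faithful C D F \<longleftrightarrow>
     (\<forall>x\<in>Obj C. \<forall>y\<in>Obj C. bij_betw (FAr F) (hom_set C x y) (hom_set D (FOb F x) (FOb F y)))"

definition inverse_functors ::
  "('o1, 'a1) cat \<Rightarrow> ('o2, 'a2) cat \<Rightarrow> ('o1, 'a1, 'o2, 'a2) fnctr
    \<Rightarrow> ('o2, 'a2, 'o1, 'a1) fnctr \<Rightarrow> bool" where
  "inverse_functors C D F G \<longleftrightarrow>
     is_functor C D F \<and> is_functor D C G \<and>
     (\<forall>x\<in>Obj C. FOb G (FOb F x) = x) \<and> (\<forall>f\<in>Arr C. FAr G (FAr F f) = f) \<and>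
     (\<forall>y\<in>Obj D. FOb F (FOb G y) = y) \<and> (\<forall>g\<in>Arr D. FAr F (FAr G g) = g)"

definition iso_of_categories ::
  "('o1, 'a1) cat \<Rightarrow> ('o2, 'a2) cat \<Rightarrow> ('o1, 'a1, 'o2, 'a2) fnctr \<Rightarrow> bool" where
  "iso_of_categories C D F \<longleftrightarrow> (\<exists>G. inverse_functors C D F G)"

definition inv_functor ::
  "('o1, 'a1) cat \<Rightarrow> ('o1, 'a1, 'o2, 'a2) fnctr \<Rightarrow> ('o2, 'a2, 'o1, 'a1) fnctr" where
  "inv_functor C F = \<lparr>FOb = inv_into (Obj C) (FOb F), FAr = inv_into (Arr C) (FAr F)\<rparr>"


section \<open>Functors into \<open>Cat\<close> and the Grothendieck construction\<close>

record ('o, 'a, 'm, 'u) indexed =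
  Fib :: "'o \<Rightarrow> ('m, 'u) cat"
  Red :: "'a \<Rightarrow> ('m, 'u, 'm, 'u) fnctr"

text \<open>A functor from the opposite of \<open>B\<close> to \<open>Cat\<close>; equality of functors is equality on the
  objects and arrows of the source category.\<close>

locale indexed_category = base: category B
  for B :: "('o, 'a) cat" +
  fixes X :: "('o, 'a, 'm, 'u) indexed"
  assumes fib: "x \<in> Obj B \<Longrightarrow> category (Fib X x)"
    and red: "f \<in> Arr B \<Longrightarrow> is_functor (Fib X (Tgt B f)) (Fib X (Src B f)) (Red X f)"
    and red_idn_ob: "\<lbrakk>x \<in> Obj B; m \<in> Obj (Fib X x)\<rbrakk> \<Longrightarrow> FOb (Red X (Idn B x)) m = m"
    and red_idn_ar: "\<lbrakk>x \<in> Obj B; u \<in> Arr (Fib X x)\<rbrakk> \<Longrightarrow> FAr (Red X (Idn B x)) u = u"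
    and red_cmp_ob: "\<lbrakk>f \<in> Arr B; g \<in> Arr B; Tgt B f = Src B g; m \<in> Obj (Fib X (Tgt B g))\<rbrakk>
        \<Longrightarrow> FOb (Red X (Cmp B g f)) m = FOb (Red X f) (FOb (Red X g) m)"
    and red_cmp_ar: "\<lbrakk>f \<in> Arr B; g \<in> Arr B; Tgt B f = Src B g; u \<in> Arr (Fib X (Tgt B g))\<rbrakk>
        \<Longrightarrow> FAr (Red X (Cmp B g f)) u = FAr (Red X f) (FAr (Red X g) u)"

text \<open>An arrow \<open>(f, u)\<close> is stored together with its source and its target, since \<open>f\<close> and \<open>u\<close>
  determine only the reduct of the target model.\<close>

definition grothendieck ::
  "('o, 'a) cat \<Rightarrow> ('o, 'a, 'm, 'u) indexed
    \<Rightarrow> ('o \<times> 'm, ('o \<times> 'm) \<times> ('a \<times> 'u) \<times> ('o \<times> 'm)) cat" where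
  "grothendieck B X = \<lparr>
     Obj = {(x, m). x \<in> Obj B \<and> m \<in> Obj (Fib X x)},
     Arr = {((x, m), (f, u), (y, n)).
              m \<in> Obj (Fib X x) \<and> n \<in> Obj (Fib X y) \<and>
              f \<in> hom_set B x y \<and> u \<in> hom_set (Fib X x) m (FOb (Red X f) n)},
     Src = (\<lambda>(p, _, _). p),
     Tgt = (\<lambda>(_, _, q). q),
     Idn = (\<lambda>(x, m). ((x, m), (Idn B x, Idn (Fib X x) m), (x, m))),
     Cmp = (\<lambda>(_, (g, v), r) ((x, m), (f, u), _).
              ((x, m), (Cmp B g f, Cmp (Fib X x) (FAr (Red X f) v) u), r))\<rparr>"


section \<open>Institutions\<close>

text \<open>Signatures, sentences, models and model homomorphisms are drawn from the types \<open>'o\<close>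
  (arrows from \<open>'a\<close>), \<open>'s\<close>, \<open>'m\<close> and \<open>'u\<close>.\<close>

record ('o, 'a, 's, 'm, 'u) institution =
  Sig :: "('o, 'a) cat"
  Sen :: "'o \<Rightarrow> 's set"
  SenMap :: "'a \<Rightarrow> 's \<Rightarrow> 's"
  Mod :: "('o, 'a, 'm, 'u) indexed"
  Sat :: "'o \<Rightarrow> 'm \<Rightarrow> 's \<Rightarrow> bool"

abbreviation Models :: "('o, 'a, 's, 'm, 'u) institution \<Rightarrow> 'o \<Rightarrow> ('m, 'u) cat" where
  "Models I x \<equiv> Fib (Mod I) x"

abbreviation reduct :: "('o, 'a, 's, 'm, 'u) institution \<Rightarrow> 'a \<Rightarrow> 'm \<Rightarrow> 'm" where
  "reduct I h \<equiv> FOb (Red (Mod I) h)"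

locale is_institution = indexed_category "Sig I" "Mod I"
  for I :: "('o, 'a, 's, 'm, 'u) institution" +
  assumes sen_map: "h \<in> Arr (Sig I)
        \<Longrightarrow> SenMap I h \<in> Sen I (Src (Sig I) h) \<rightarrow> Sen I (Tgt (Sig I) h)"
    and sen_idn: "\<lbrakk>x \<in> Obj (Sig I); \<phi> \<in> Sen I x\<rbrakk> \<Longrightarrow> SenMap I (Idn (Sig I) x) \<phi> = \<phi>"
    and sen_cmp: "\<lbrakk>f \<in> Arr (Sig I); g \<in> Arr (Sig I); Tgt (Sig I) f = Src (Sig I) g;
          \<phi> \<in> Sen I (Src (Sig I) f)\<rbrakk>
        \<Longrightarrow> SenMap I (Cmp (Sig I) g f) \<phi> = SenMap I g (SenMap I f \<phi>)"
    and satisfaction: "\<lbrakk>h \<in> hom_set (Sig I) x y; m \<in> Obj (Models I y); \<phi> \<in> Sen I x\<rbrakk>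
        \<Longrightarrow> Sat I y m (SenMap I h \<phi>) \<longleftrightarrow> Sat I x (reduct I h m) \<phi>"

definition model_star :: "('o, 'a, 's, 'm, 'u) institution \<Rightarrow> 'o \<Rightarrow> 'm \<Rightarrow> 's set" where
  "model_star I x m = {\<phi> \<in> Sen I x. Sat I x m \<phi>}"

definition sentence_star :: "('o, 'a, 's, 'm, 'u) institution \<Rightarrow> 'o \<Rightarrow> 's \<Rightarrow> 'm set" where
  "sentence_star I x \<phi> = {m \<in> Obj (Models I x). Sat I x m \<phi>}"

locale institution_morphism =
  J: is_institution J + I: is_institution I + sig: is_functor "Sig J" "Sig I" \<phi>
  for J :: "('o2, 'a2, 's2, 'm2, 'u2) institution"
    and I :: "('o1, 'a1, 's1, 'm1, 'u1) institution"
    and \<phi> :: "('o2, 'a2, 'o1, 'a1) fnctr" +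
  fixes \<alpha> :: "'o2 \<Rightarrow> 's1 \<Rightarrow> 's2"
    and \<beta> :: "'o2 \<Rightarrow> ('m2, 'u2, 'm1, 'u1) fnctr"
  assumes sen: "x \<in> Obj (Sig J) \<Longrightarrow> \<alpha> x \<in> Sen I (FOb \<phi> x) \<rightarrow> Sen J x"
    and sen_natural: "\<lbrakk>h \<in> hom_set (Sig J) x y; \<psi> \<in> Sen I (FOb \<phi> x)\<rbrakk>
        \<Longrightarrow> \<alpha> y (SenMap I (FAr \<phi> h) \<psi>) = SenMap J h (\<alpha> x \<psi>)"
    and mod: "x \<in> Obj (Sig J) \<Longrightarrow> is_functor (Models J x) (Models I (FOb \<phi> x)) (\<beta> x)"
    and mod_natural_ob: "\<lbrakk>h \<in> hom_set (Sig J) x y; m \<in> Obj (Models J y)\<rbrakk>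
        \<Longrightarrow> FOb (\<beta> x) (FOb (Red (Mod J) h) m) = FOb (Red (Mod I) (FAr \<phi> h)) (FOb (\<beta> y) m)"
    and mod_natural_ar: "\<lbrakk>h \<in> hom_set (Sig J) x y; u \<in> Arr (Models J y)\<rbrakk>
        \<Longrightarrow> FAr (\<beta> x) (FAr (Red (Mod J) h) u) = FAr (Red (Mod I) (FAr \<phi> h)) (FAr (\<beta> y) u)"
    and sat: "\<lbrakk>x \<in> Obj (Sig J); m \<in> Obj (Models J x); \<psi> \<in> Sen I (FOb \<phi> x)\<rbrakk>
        \<Longrightarrow> Sat J x m (\<alpha> x \<psi>) \<longleftrightarrow> Sat I (FOb \<phi> x) (FOb (\<beta> x) m) \<psi>"

definition semantically_surjective ::
  "('o, 'a, 's, 'm, 'u) institution \<Rightarrow> 'o \<Rightarrow> 't set \<Rightarrow> ('t \<Rightarrow> 's) \<Rightarrow> bool" where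
  "semantically_surjective J x T a \<longleftrightarrow>
     (\<forall>\<phi>\<in>Sen J x. \<exists>\<psi>\<in>a ` T. sentence_star J x \<phi> = sentence_star J x \<psi>)"


section \<open>Presentations\<close>

definition satisfies_all :: "('o, 'a, 's, 'm, 'u) institution \<Rightarrow> 'o \<times> 's set \<Rightarrow> 'm \<Rightarrow> bool" where
  "satisfies_all I P m \<longleftrightarrow> (\<forall>\<phi>\<in>snd P. Sat I (fst P) m \<phi>)"

definition Pres ::
  "('o, 'a, 's, 'm, 'u) institution
    \<Rightarrow> ('o \<times> 's set, ('o \<times> 's set) \<times> 'a \<times> ('o \<times> 's set)) cat" where
  "Pres I = \<lparr>
     Obj = {(x, E). x \<in> Obj (Sig I) \<and> E \<subseteq> Sen I x},
     Arr = {((x, E), f, (y, E')).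
              E \<subseteq> Sen I x \<and> E' \<subseteq> Sen I y \<and> f \<in> hom_set (Sig I) x y \<and> SenMap I f ` E \<subseteq> E'},
     Src = (\<lambda>(p, _, _). p),
     Tgt = (\<lambda>(_, _, q). q),
     Idn = (\<lambda>p. (p, Idn (Sig I) (fst p), p)),
     Cmp = (\<lambda>(_, g, r) (p, f, _). (p, Cmp (Sig I) g f, r))\<rparr>"

definition ModPres ::
  "('o, 'a, 's, 'm, 'u) institution
    \<Rightarrow> ('o \<times> 's set, ('o \<times> 's set) \<times> 'a \<times> ('o \<times> 's set), 'm, 'u) indexed" where
  "ModPres I = \<lparr>
     Fib = (\<lambda>P. full_subcat (Models I (fst P)) (satisfies_all I P)),
     Red = (\<lambda>(_, f, _). Red (Mod I) f)\<rparr>"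


section \<open>Inclusion systems and skolemizations\<close>

text \<open>A broad subcategory is given by its set of arrows.\<close>

definition broad_subcategory :: "('o, 'a) cat \<Rightarrow> 'a set \<Rightarrow> bool" where
  "broad_subcategory C U \<longleftrightarrow>
     U \<subseteq> Arr C \<and> (\<forall>x\<in>Obj C. Idn C x \<in> U) \<and>
     (\<forall>f\<in>U. \<forall>g\<in>U. Tgt C f = Src C g \<longrightarrow> Cmp C g f \<in> U)"

definition partial_order_arrows :: "('o, 'a) cat \<Rightarrow> 'a set \<Rightarrow> bool" where
  "partial_order_arrows C U \<longleftrightarrow>
     (\<forall>f\<in>U. \<forall>g\<in>U. Src C f = Src C g \<and> Tgt C f = Tgt C g \<longrightarrow> f = g) \<and>
     (\<forall>f\<in>U. \<forall>g\<in>U. Src C f = Tgt C g \<and> Tgt C f = Src C g \<longrightarrow> Src C f = Tgt C f)"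

definition inclusion_system :: "('o, 'a) cat \<Rightarrow> 'a set \<times> 'a set \<Rightarrow> bool" where
  "inclusion_system C = (\<lambda>(U, E).
     broad_subcategory C U \<and> broad_subcategory C E \<and> partial_order_arrows C U \<and>
     (\<forall>f\<in>Arr C. \<exists>!(e, i). e \<in> E \<and> i \<in> U \<and> Tgt C e = Src C i \<and> Cmp C i e = f))"

definition inclusion :: "('o, 'a) cat \<Rightarrow> 'a set \<times> 'a set \<Rightarrow> 'o \<Rightarrow> 'o \<Rightarrow> bool" where
  "inclusion C UE m n \<longleftrightarrow> (\<exists>u\<in>fst UE. Src C u = m \<and> Tgt C u = n)"

text \<open>The assignment of the presentation \<open>(\<Sigma>\<^sub>S, S\<^sub>\<Sigma>)\<close> to \<open>\<Sigma>\<close> is a component of its own, because the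
  functor does not determine it on signatures without models.\<close>

record ('o, 'a, 's, 'm, 'u) skolem =
  SkFun :: "('o \<times> 'm, ('o \<times> 'm) \<times> ('a \<times> 'u) \<times> ('o \<times> 'm),
             ('o \<times> 's set) \<times> 'm,
             (('o \<times> 's set) \<times> 'm) \<times> ((('o \<times> 's set) \<times> 'a \<times> ('o \<times> 's set)) \<times> 'u)
               \<times> (('o \<times> 's set) \<times> 'm)) fnctr"
  SkPres :: "'o \<Rightarrow> 'o \<times> 's set"
  SkIncl :: "'o \<Rightarrow> 'u set \<times> 'u set"
  SkTau :: "'o \<Rightarrow> 'a"

definition SkSig :: "('o, 'a, 's, 'm, 'u) skolem \<Rightarrow> 'o \<Rightarrow> 'o" where
  "SkSig K x = fst (SkPres K x)"

definition SkMod :: "('o, 'a, 's, 'm, 'u) skolem \<Rightarrow> 'o \<Rightarrow> 'm \<Rightarrow> 'm" where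
  "SkMod K x m = snd (FOb (SkFun K) (x, m))"

definition skolemization_of ::
  "('o, 'a, 's, 'm, 'u) institution \<Rightarrow> ('o, 'a, 's, 'm, 'u) skolem \<Rightarrow> 'o \<Rightarrow> 'm \<Rightarrow> 'm \<Rightarrow> bool" where
  "skolemization_of I K x m' m \<longleftrightarrow>
     m' \<in> Obj (Models I (SkSig K x)) \<and> reduct I (SkTau K x) m' = m \<and>
     satisfies_all I (SkPres K x) m'"

locale skolemization = is_institution I
  for I :: "('o, 'a, 's, 'm, 'u) institution" +
  fixes K :: "('o, 'a, 's, 'm, 'u) skolem"
  assumes sk_functor:
      "is_functor (grothendieck (Sig I) (Mod I)) (grothendieck (Pres I) (ModPres I)) (SkFun K)"
    and sk_pres: "x \<in> Obj (Sig I) \<Longrightarrow> SkPres K x \<in> Obj (Pres I)"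
    and sk_functor_pres: "\<lbrakk>x \<in> Obj (Sig I); m \<in> Obj (Models I x)\<rbrakk>
        \<Longrightarrow> fst (FOb (SkFun K) (x, m)) = SkPres K x"
    and sk_tau: "x \<in> Obj (Sig I) \<Longrightarrow> SkTau K x \<in> hom_set (Sig I) x (SkSig K x)"
    and sk_reduct: "\<lbrakk>x \<in> Obj (Sig I); m \<in> Obj (Models I x)\<rbrakk>
        \<Longrightarrow> reduct I (SkTau K x) (SkMod K x m) = m"
    and sk_inclusion_system: "x \<in> Obj (Sig I)
        \<Longrightarrow> inclusion_system (Models I (SkSig K x)) (SkIncl K x)"
    and sk_elementary: "\<lbrakk>x \<in> Obj (Sig I); m \<in> Obj (Models I x); n \<in> Obj (Models I x);
          skolemization_of I K x m' m; skolemization_of I K x n' n;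
          inclusion (Models I (SkSig K x)) (SkIncl K x) m' n'\<rbrakk>
        \<Longrightarrow> model_star I x m = model_star I x n"


section \<open>Well-definedness of the constructions\<close>

lemma (in category) inverse_arrows_unique:
  assumes "inverse_arrows C f g" "inverse_arrows C f h" shows "g = h"
  using assms unfolding inverse_arrows_def hom_set_def
  by (smt (verit, ccfv_threshold) mem_Collect_eq cmp_assoc cmp_idn_left cmp_idn_right)

lemma (in category) inv_arrow: "iso_arrow C f \<Longrightarrow> inverse_arrows C f (inv_arrow C f)"
  unfolding iso_arrow_def inv_arrow_def by (metis inverse_arrows_unique theI)

lemma inv_functor:
  assumes "inverse_functors C D F G"
  shows "\<And>y. y \<in> Obj D \<Longrightarrow> FOb (inv_functor C F) y = FOb G y"
    "\<And>g. g \<in> Arr D \<Longrightarrow> FAr (inv_functor C F) g = FAr G g"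
proof -
  interpret F: is_functor C D F using assms by (simp add: inverse_functors_def)
  interpret G: is_functor D C G using assms by (simp add: inverse_functors_def)
  have "inj_on (FOb F) (Obj C)" "inj_on (FAr F) (Arr C)"
    using assms by (auto simp: inverse_functors_def intro: inj_on_inverseI)
  then show "\<And>y. y \<in> Obj D \<Longrightarrow> FOb (inv_functor C F) y = FOb G y"
    "\<And>g. g \<in> Arr D \<Longrightarrow> FAr (inv_functor C F) g = FAr G g"
    using assms G.ob G.ar unfolding inverse_functors_def inv_functor_def
    by (simp_all, (metis inv_into_f_f)+)
qed

lemma category_full_subcat:
  assumes "category C" shows "category (full_subcat C P)"
proof -
  interpret category C by fact
  show ?thesis
    by unfold_locales (auto simp: full_subcat_def src_obj tgt_obj idn_arr src_idn tgt_idn cmp_arr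
        src_cmp tgt_cmp cmp_idn_right cmp_idn_left cmp_assoc)
qed

lemma (in indexed_category) category_grothendieck: "category (grothendieck B X)"
proof -
  note fc = fib[THEN category.src_obj] fib[THEN category.tgt_obj] fib[THEN category.idn_arr]
    fib[THEN category.src_idn] fib[THEN category.tgt_idn] fib[THEN category.cmp_arr]
    fib[THEN category.src_cmp] fib[THEN category.tgt_cmp]
    fib[THEN category.cmp_idn_right] fib[THEN category.cmp_idn_left] fib[THEN category.cmp_assoc]
  note rc = red[THEN is_functor.ob] red[THEN is_functor.ar] red[THEN is_functor.src]
    red[THEN is_functor.tgt] red[THEN is_functor.idn] red[THEN is_functor.cmp]
  note bc = base.src_obj base.tgt_obj base.idn_arr base.src_idn base.tgt_idn base.cmp_arr
    base.src_cmp base.tgt_cmp base.cmp_idn_right base.cmp_idn_left base.cmp_assoc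
  note xc = red_idn_ob red_idn_ar red_cmp_ob red_cmp_ar
  have cmp_cmp: "Cmp (Fib X (Src B f)) (FAr (Red X (Cmp B g f)) w) (Cmp (Fib X (Src B f)) (FAr (Red X f) v) u)
     = Cmp (Fib X (Src B f)) (FAr (Red X f) (Cmp (Fib X (Src B g)) (FAr (Red X g) w) v)) u"
    if fg: "f \<in> Arr B" "g \<in> Arr B" "Tgt B f = Src B g" "w \<in> Arr (Fib X (Tgt B g))"
      "v \<in> Arr (Fib X (Src B g))" "u \<in> Arr (Fib X (Src B f))"
      "Tgt (Fib X (Src B f)) u = FOb (Red X f) (Src (Fib X (Src B g)) v)"
      "Tgt (Fib X (Src B g)) v = FOb (Red X g) (Src (Fib X (Tgt B g)) w)" for f g u v w
  proof -
    interpret f: is_functor "Fib X (Src B g)" "Fib X (Src B f)" "Red X f" using red[of f] fg by simp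
    interpret g: is_functor "Fib X (Tgt B g)" "Fib X (Src B g)" "Red X g" using red[of g] fg by simp
    show ?thesis using fg
      by (simp add: red_cmp_ar f.cmp g.ar g.src f.ar f.src f.tgt f.tgt.cmp_assoc)
  qed
  show ?thesis
    apply unfold_locales
              apply (auto simp: grothendieck_def hom_set_def bc fc rc xc)[8]
    subgoal apply (auto simp: grothendieck_def hom_set_def bc fc rc xc) done
    subgoal apply (auto simp: grothendieck_def hom_set_def bc fc rc xc) by (metis base.src_obj fc(10))
    subgoal by (auto simp: grothendieck_def hom_set_def bc intro!: cmp_cmp)
    done
qed

lemma (in is_institution) category_Pres: "category (Pres I)"
  using sen_map
  apply unfold_locales
  apply (auto simp: Pres_def hom_set_def base.src_obj base.tgt_obj base.idn_arr base.src_idn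
    base.tgt_idn base.cmp_arr base.src_cmp base.tgt_cmp base.cmp_idn_right base.cmp_idn_left
    base.cmp_assoc subset_iff sen_idn sen_cmp image_subset_iff)
  done

lemma (in is_institution) indexed_category_ModPres: "indexed_category (Pres I) (ModPres I)"
proof -
  interpret P: category "Pres I" by (rule category_Pres)
  show ?thesis
  proof (intro indexed_category.intro P.category_axioms indexed_category_axioms.intro)
    fix x assume "x \<in> Obj (Pres I)"
    then show "category (Fib (ModPres I) x)"
      by (auto simp: ModPres_def Pres_def intro!: category_full_subcat fib)
  next
    fix f assume f: "f \<in> Arr (Pres I)"
    then obtain x E h y E' where h: "f = ((x,E),h,(y,E'))" "E \<subseteq> Sen I x" "E' \<subseteq> Sen I y"
      "h \<in> hom_set (Sig I) x y" "SenMap I h ` E \<subseteq> E'" by (auto simp: Pres_def)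
    then have h': "h \<in> Arr (Sig I)" "Src (Sig I) h = x" "Tgt (Sig I) h = y"
      by (auto simp: hom_set_def)
    interpret R: is_functor "Models I y" "Models I x" "Red (Mod I) h" using red[OF h'(1)] h' by simp
    have sat: "satisfies_all I (x,E) (reduct I h m)"
      if "m \<in> Obj (Models I y)" "satisfies_all I (y,E') m" for m
      using that h(2,3,5) satisfaction[OF h(4)] unfolding satisfies_all_def
      by (simp add: image_subset_iff) blast
    have "is_functor (full_subcat (Models I y) (satisfies_all I (y,E')))
       (full_subcat (Models I x) (satisfies_all I (x,E))) (Red (Mod I) h)"
      apply (intro is_functor.intro category_full_subcat R.src.category_axioms R.tgt.category_axioms)
      apply unfold_locales
      apply (auto simp: full_subcat_def sat R.ob R.ar R.src R.tgt R.idn R.cmp R.src.src_obj R.src.tgt_obj)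
      done
    then show "is_functor (Fib (ModPres I) (Tgt (Pres I) f)) (Fib (ModPres I) (Src (Pres I) f))
            (Red (ModPres I) f)"
      by (simp add: h(1) Pres_def ModPres_def)
  qed (auto simp: Pres_def ModPres_def full_subcat_def hom_set_def red_idn_ob red_idn_ar red_cmp_ob red_cmp_ar)
qed

end

theory Submission
  imports Defs
begin

text \<open>
  The new Skolem functor applies \<open>(\<phi>, \<beta>)\<close>, then the given Skolem functor, then transports
  presentations and models from \<open>(\<phi>\<Sigma>)\<^sub>S\<close> to \<open>til \<Sigma>\<close>. A signature arrow \<open>g\<close> between Skolem signatures
  is transported to the unique arrow over its conjugate \<open>i\<inverse> \<circ> g \<circ> i\<close>, a Skolem axiom \<open>s\<close> to
  \<open>\<alpha>(Sen(i\<inverse>)(s))\<close>, and models along the isomorphism of categories \<open>\<beta>\<inverse> \<circ> Mod(i)\<close>, which is natural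
  in \<open>g\<close>. Under the inverse isomorphism \<open>Mod(i\<inverse>) \<circ> \<beta>\<close> the skolemizations of \<open>m\<close> correspond to
  those of \<open>\<beta> m\<close>, so an inclusion from a skolemization of \<open>m\<close> to one of \<open>n\<close> gives
  \<open>(\<beta> m)\<^sup>* = (\<beta> n)\<^sup>*\<close>, and semantic surjectivity of \<open>\<alpha>\<close> turns this into \<open>m\<^sup>* = n\<^sup>*\<close>.
\<close>

section \<open>Functors and their inverses\<close>

lemma (in category) hom_obj:
  assumes "f \<in> hom_set C x y"
  shows "x \<in> Obj C" and "y \<in> Obj C"
  using assms by (auto simp: hom_set_def src_obj tgt_obj)

lemma (in category) idn_hom: "x \<in> Obj C \<Longrightarrow> Idn C x \<in> hom_set C x x"
  by (auto simp: hom_set_def idn_arr src_idn tgt_idn)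

lemma (in category) cmp_hom:
  "\<lbrakk>f \<in> hom_set C x y; g \<in> hom_set C y z\<rbrakk> \<Longrightarrow> Cmp C g f \<in> hom_set C x z"
  by (auto simp: hom_set_def cmp_arr src_cmp tgt_cmp)

lemma (in category) cmp_assoc_hom:
  "\<lbrakk>f \<in> hom_set C w x; g \<in> hom_set C x y; h \<in> hom_set C y z\<rbrakk>
    \<Longrightarrow> Cmp C (Cmp C h g) f = Cmp C h (Cmp C g f)"
  by (auto simp: hom_set_def cmp_assoc)

lemma (in category) cmp_idn_hom:
  assumes "f \<in> hom_set C x y"
  shows "Cmp C f (Idn C x) = f" and "Cmp C (Idn C y) f = f"
  using assms by (auto simp: hom_set_def cmp_idn_right cmp_idn_left)

lemma (in is_functor) ar_hom:
  "f \<in> hom_set C x y \<Longrightarrow> FAr F f \<in> hom_set D (FOb F x) (FOb F y)"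
  by (auto simp: hom_set_def ar src tgt)

lemma (in is_functor) cmp_hom:
  "\<lbrakk>f \<in> hom_set C x y; g \<in> hom_set C y z\<rbrakk>
    \<Longrightarrow> FAr F (Cmp C g f) = Cmp D (FAr F g) (FAr F f)"
  by (auto simp: hom_set_def cmp)

definition functor_eq ::
  "('o1, 'a1) cat \<Rightarrow> ('o1, 'a1, 'o2, 'a2) fnctr \<Rightarrow> ('o1, 'a1, 'o2, 'a2) fnctr \<Rightarrow> bool" where
  "functor_eq C F G \<longleftrightarrow>
     (\<forall>x\<in>Obj C. FOb F x = FOb G x) \<and> (\<forall>f\<in>Arr C. FAr F f = FAr G f)"

lemma functor_eq_sym: "functor_eq C F G \<Longrightarrow> functor_eq C G F"
  by (simp add: functor_eq_def)

lemma functor_eq_trans [trans]: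
  "\<lbrakk>functor_eq C F G; functor_eq C G H\<rbrakk> \<Longrightarrow> functor_eq C F H"
  by (simp add: functor_eq_def)

lemma functor_eq_comp_left:
  "functor_eq C F G \<Longrightarrow> functor_eq C (functor_comp H F) (functor_comp H G)"
  by (simp add: functor_eq_def functor_comp_def)

lemma functor_eq_comp_right:
  assumes "is_functor C D F" "functor_eq D G H"
  shows "functor_eq C (functor_comp G F) (functor_comp H F)"
  using assms(2) by (simp add: functor_eq_def functor_comp_def is_functor.ob[OF assms(1)]
      is_functor.ar[OF assms(1)])

lemma functor_comp_assoc: "functor_comp (functor_comp H G) F = functor_comp H (functor_comp G F)"
  by (simp add: functor_comp_def comp_assoc)

lemma is_functor_functor_comp:
  assumes "is_functor C D F" "is_functor D E G"
  shows "is_functor C E (functor_comp G F)"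
proof -
  interpret F: is_functor C D F by fact
  interpret G: is_functor D E G by fact
  show ?thesis
    by unfold_locales (simp_all add: functor_comp_def F.ob F.ar F.src F.tgt F.idn F.cmp
        G.ob G.ar G.src G.tgt G.idn G.cmp)
qed

lemma is_functor_cong:
  assumes "is_functor C D F" "functor_eq C G F"
  shows "is_functor C D G"
proof -
  interpret F: is_functor C D F by fact
  have "FOb G x = FOb F x" if "x \<in> Obj C" for x
    using assms(2) that by (simp add: functor_eq_def)
  moreover have "FAr G f = FAr F f" if "f \<in> Arr C" for f
    using assms(2) that by (simp add: functor_eq_def)
  ultimately show ?thesis
    by unfold_locales (simp_all add: F.ob F.ar F.src F.tgt F.idn F.cmp
        F.src.src_obj F.src.tgt_obj F.src.idn_arr F.src.cmp_arr)
qed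

lemma is_functor_full_subcat:
  assumes "is_functor C D F" "\<And>x. \<lbrakk>x \<in> Obj C; P x\<rbrakk> \<Longrightarrow> Q (FOb F x)"
  shows "is_functor (full_subcat C P) (full_subcat D Q) F"
proof -
  interpret F: is_functor C D F by fact
  interpret CP: category "full_subcat C P" by (rule category_full_subcat[OF F.src.category_axioms])
  interpret DQ: category "full_subcat D Q" by (rule category_full_subcat[OF F.tgt.category_axioms])
  show ?thesis
    by unfold_locales (auto simp: full_subcat_def assms(2) F.ob F.ar F.src F.tgt F.idn F.cmp
        F.src.src_obj F.src.tgt_obj)
qed

lemma inverse_functors_sym: "inverse_functors C D F G \<Longrightarrow> inverse_functors D C G F"
  by (simp add: inverse_functors_def)

lemma inverse_functors_comp:
  assumes "inverse_functors C D F G" "inverse_functors D E F' G'"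
  shows "inverse_functors C E (functor_comp F' F) (functor_comp G G')"
proof -
  interpret F: is_functor C D F using assms(1) by (simp add: inverse_functors_def)
  interpret G': is_functor E D G' using assms(2) by (simp add: inverse_functors_def)
  show ?thesis
    using assms unfolding inverse_functors_def
    by (auto intro: is_functor_functor_comp)
      (simp_all add: functor_comp_def F.ob F.ar G'.ob G'.ar)
qed

lemma inverse_functors_inv_functor:
  assumes "iso_of_categories C D F"
  shows "inverse_functors C D F (inv_functor C F)"
proof -
  obtain G where G: "inverse_functors C D F G"
    using assms by (auto simp: iso_of_categories_def)
  interpret F: is_functor C D F using G by (simp add: inverse_functors_def)
  have "is_functor D C G" using G by (simp add: inverse_functors_def)
  moreover have "functor_eq D (inv_functor C F) G"
    by (simp add: functor_eq_def inv_functor[OF G])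
  ultimately have "is_functor D C (inv_functor C F)"
    by (rule is_functor_cong)
  then show ?thesis
    using G by (simp add: inverse_functors_def inv_functor[OF G] F.ob F.ar)
qed

lemma inverse_functors_natural:
  assumes "inverse_functors C D F G" "inverse_functors C' D' F' G'" "is_functor D D' R'"
    and "functor_eq D (functor_comp G' R') (functor_comp R G)"
  shows "functor_eq C (functor_comp F' R) (functor_comp R' F)"
proof -
  interpret F: is_functor C D F using assms(1) by (simp add: inverse_functors_def)
  interpret R': is_functor D D' R' by fact
  have "FOb F' (FOb R x) = FOb R' (FOb F x)" if "x \<in> Obj C" for x
    using assms that unfolding inverse_functors_def functor_eq_def functor_comp_def
    by simp (metis F.ob R'.ob)
  moreover have "FAr F' (FAr R f) = FAr R' (FAr F f)" if "f \<in> Arr C" for f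
    using assms that unfolding inverse_functors_def functor_eq_def functor_comp_def
    by simp (metis F.ar R'.ar)
  ultimately show ?thesis by (simp add: functor_eq_def functor_comp_def)
qed

section \<open>Inclusion systems\<close>

definition factorizations :: "('o, 'a) cat \<Rightarrow> 'a set \<times> 'a set \<Rightarrow> 'a \<Rightarrow> ('a \<times> 'a) set" where
  "factorizations C = (\<lambda>(U, E) f.
     {(e, i). e \<in> E \<and> i \<in> U \<and> Tgt C e = Src C i \<and> Cmp C i e = f})"

lemma inclusion_system_iff_factorizations:
  "inclusion_system C (U, E) \<longleftrightarrow>
     broad_subcategory C U \<and> broad_subcategory C E \<and> partial_order_arrows C U \<and>
     (\<forall>f\<in>Arr C. is_singleton (factorizations C (U, E) f))"
  by (simp add: inclusion_system_def factorizations_def is_singleton_iff_ex1 case_prod_unfold)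

locale inverse_functor_pair =
  fixes C :: "('o1, 'a1) cat" and D :: "('o2, 'a2) cat" and F G
  assumes inverse: "inverse_functors C D F G"
begin

sublocale F: is_functor C D F using inverse by (simp add: inverse_functors_def)
sublocale G: is_functor D C G using inverse by (simp add: inverse_functors_def)

lemma GF_ob: "x \<in> Obj C \<Longrightarrow> FOb G (FOb F x) = x"
  and GF_ar: "f \<in> Arr C \<Longrightarrow> FAr G (FAr F f) = f"
  and FG_ob: "y \<in> Obj D \<Longrightarrow> FOb F (FOb G y) = y"
  and FG_ar: "g \<in> Arr D \<Longrightarrow> FAr F (FAr G g) = g"
  using inverse by (simp_all add: inverse_functors_def)

lemma FOb_eq_iff: "\<lbrakk>x \<in> Obj C; y \<in> Obj C\<rbrakk> \<Longrightarrow> FOb F x = FOb F y \<longleftrightarrow> x = y"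
  by (metis GF_ob)

lemma FAr_eq_iff: "\<lbrakk>f \<in> Arr C; g \<in> Arr C\<rbrakk> \<Longrightarrow> FAr F f = FAr F g \<longleftrightarrow> f = g"
  by (metis GF_ar)

lemma endpoints_eq_iff:
  assumes "f \<in> Arr C" "g \<in> Arr C"
  shows "Src D (FAr F f) = Src D (FAr F g) \<longleftrightarrow> Src C f = Src C g"
    and "Tgt D (FAr F f) = Tgt D (FAr F g) \<longleftrightarrow> Tgt C f = Tgt C g"
    and "Tgt D (FAr F f) = Src D (FAr F g) \<longleftrightarrow> Tgt C f = Src C g"
    and "Src D (FAr F f) = Tgt D (FAr F g) \<longleftrightarrow> Src C f = Tgt C g"
  using assms by (simp_all add: F.src F.tgt FOb_eq_iff F.src.src_obj F.src.tgt_obj)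

lemma broad_subcategory_image:
  assumes "broad_subcategory C U"
  shows "broad_subcategory D (FAr F ` U)"
proof -
  have U: "f \<in> Arr C" if "f \<in> U" for f
    using assms that by (auto simp: broad_subcategory_def)
  have "Idn D y \<in> FAr F ` U" if "y \<in> Obj D" for y
  proof -
    have "Idn D y = FAr F (Idn C (FOb G y))"
      using that by (simp add: F.idn G.ob FG_ob)
    then show ?thesis
      using assms that by (simp add: broad_subcategory_def G.ob)
  qed
  moreover have "Cmp D (FAr F g) (FAr F f) \<in> FAr F ` U"
    if "f \<in> U" "g \<in> U" "Tgt D (FAr F f) = Src D (FAr F g)" for f g
  proof -
    have fg: "Tgt C f = Src C g" using that by (simp add: endpoints_eq_iff U)
    then have "Cmp C g f \<in> U" using assms that by (simp add: broad_subcategory_def)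
    then show ?thesis
      using that fg by (simp add: F.cmp[OF U U, symmetric])
  qed
  ultimately show ?thesis
    using U by (auto simp: broad_subcategory_def F.ar)
qed

lemma partial_order_arrows_image:
  assumes "partial_order_arrows C U" "U \<subseteq> Arr C"
  shows "partial_order_arrows D (FAr F ` U)"
proof -
  have "f \<in> Arr C" if "f \<in> U" for f using assms(2) that by auto
  then show ?thesis
    using assms(1) unfolding partial_order_arrows_def by (simp add: endpoints_eq_iff FAr_eq_iff)
qed

lemma factorizations_image:
  assumes "U \<subseteq> Arr C" "E \<subseteq> Arr C" "f \<in> Arr C"
  shows "factorizations D (FAr F ` U, FAr F ` E) (FAr F f)
    = map_prod (FAr F) (FAr F) ` factorizations C (U, E) f"
proof -
  have "Tgt D (FAr F e) = Src D (FAr F i) \<and> Cmp D (FAr F i) (FAr F e) = FAr F f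
      \<longleftrightarrow> Tgt C e = Src C i \<and> Cmp C i e = f" if "e \<in> E" "i \<in> U" for e i
  proof -
    have ei: "e \<in> Arr C" "i \<in> Arr C" using assms that by auto
    then show ?thesis
      using assms(3)
      by (auto simp: endpoints_eq_iff F.cmp[symmetric] FAr_eq_iff F.src.cmp_arr)
  qed
  then show ?thesis by (fastforce simp: factorizations_def image_iff)
qed

lemma inclusion_system_image:
  assumes "inclusion_system C (U, E)"
  shows "inclusion_system D (FAr F ` U, FAr F ` E)"
proof -
  have UE: "U \<subseteq> Arr C" "E \<subseteq> Arr C"
    using assms by (simp_all add: inclusion_system_iff_factorizations broad_subcategory_def)
  have "is_singleton (factorizations D (FAr F ` U, FAr F ` E) g)" if "g \<in> Arr D" for g
  proof -
    have "is_singleton (factorizations C (U, E) (FAr G g))"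
      using assms that by (simp add: inclusion_system_iff_factorizations G.ar)
    then show ?thesis
      using factorizations_image[OF UE G.ar[OF that]] that
      by (auto simp: is_singleton_def FG_ar)
  qed
  then show ?thesis
    using assms UE by (simp add: inclusion_system_iff_factorizations broad_subcategory_image
        partial_order_arrows_image)
qed

lemma inclusion_image:
  assumes "U \<subseteq> Arr C" "inclusion D (FAr F ` U, E) m n"
  shows "inclusion C (U, E') (FOb G m) (FOb G n)"
proof -
  obtain u where "u \<in> U" "Src D (FAr F u) = m" "Tgt D (FAr F u) = n"
    using assms(2) by (auto simp: inclusion_def)
  moreover from this assms(1) have "u \<in> Arr C" by auto
  ultimately show ?thesis
    by (auto simp: inclusion_def F.src F.tgt GF_ob F.src.src_obj F.src.tgt_obj)
qed

end

section \<open>Indexed categories\<close>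

lemma (in indexed_category) red_hom:
  "f \<in> hom_set B x y \<Longrightarrow> is_functor (Fib X y) (Fib X x) (Red X f)"
  using red by (auto simp: hom_set_def)

lemma (in indexed_category) red_cmp:
  assumes "f \<in> hom_set B x y" "g \<in> hom_set B y z"
  shows "functor_eq (Fib X z) (Red X (Cmp B g f)) (functor_comp (Red X f) (Red X g))"
  using assms by (auto simp: functor_eq_def functor_comp_def hom_set_def red_cmp_ob red_cmp_ar)

lemma (in indexed_category) inverse_functors_Red:
  assumes "inverse_arrows B f g" "f \<in> hom_set B x y"
  shows "inverse_functors (Fib X y) (Fib X x) (Red X f) (Red X g)"
proof -
  have fg: "f \<in> Arr B" "g \<in> Arr B" "Src B f = x" "Tgt B f = y" "Src B g = y" "Tgt B g = x"
      "Cmp B g f = Idn B x" "Cmp B f g = Idn B y" "x \<in> Obj B" "y \<in> Obj B"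
    using assms base.hom_obj[OF assms(2)] by (auto simp: inverse_arrows_def hom_set_def)
  show ?thesis
    unfolding inverse_functors_def
    using red[OF fg(1)] red[OF fg(2)] fg
      red_cmp_ob[of f g] red_cmp_ob[of g f] red_cmp_ar[of f g] red_cmp_ar[of g f]
    by (simp add: red_idn_ob red_idn_ar)
qed

locale indexed_functor =
  source: indexed_category B X + target: indexed_category B' X' + base: is_functor B B' \<phi>
  for B :: "('o1, 'a1) cat" and X :: "('o1, 'a1, 'm1, 'u1) indexed"
    and B' :: "('o2, 'a2) cat" and X' :: "('o2, 'a2, 'm2, 'u2) indexed"
    and \<phi> :: "('o1, 'a1, 'o2, 'a2) fnctr" +
  fixes \<beta> :: "'o1 \<Rightarrow> ('m1, 'u1, 'm2, 'u2) fnctr"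
  assumes component: "x \<in> Obj B \<Longrightarrow> is_functor (Fib X x) (Fib X' (FOb \<phi> x)) (\<beta> x)"
    and natural: "h \<in> hom_set B x y
      \<Longrightarrow> functor_eq (Fib X y) (functor_comp (\<beta> x) (Red X h))
            (functor_comp (Red X' (FAr \<phi> h)) (\<beta> y))"

definition grothendieck_map ::
  "('o1, 'a1, 'o2, 'a2) fnctr \<Rightarrow> ('o1 \<Rightarrow> ('m1, 'u1, 'm2, 'u2) fnctr)
    \<Rightarrow> ('o1 \<times> 'm1, ('o1 \<times> 'm1) \<times> ('a1 \<times> 'u1) \<times> ('o1 \<times> 'm1),
        'o2 \<times> 'm2, ('o2 \<times> 'm2) \<times> ('a2 \<times> 'u2) \<times> ('o2 \<times> 'm2)) fnctr" where
  "grothendieck_map \<phi> \<beta> = \<lparr>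
     FOb = (\<lambda>(x, m). (FOb \<phi> x, FOb (\<beta> x) m)),
     FAr = (\<lambda>((x, m), (f, u), (y, n)).
       ((FOb \<phi> x, FOb (\<beta> x) m), (FAr \<phi> f, FAr (\<beta> x) u), (FOb \<phi> y, FOb (\<beta> y) n)))\<rparr>"

theorem (in indexed_functor) is_functor_grothendieck_map:
  "is_functor (grothendieck B X) (grothendieck B' X') (grothendieck_map \<phi> \<beta>)"
    (is "is_functor ?S ?T ?F")
proof (intro is_functor.intro is_functor_axioms.intro source.category_grothendieck
    target.category_grothendieck)
  fix p assume "p \<in> Obj ?S"
  then show "FOb ?F p \<in> Obj ?T" and "FAr ?F (Idn ?S p) = Idn ?T (FOb ?F p)"
    by (auto simp: grothendieck_def grothendieck_map_def base.ob base.idn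
        is_functor.ob[OF component] is_functor.idn[OF component])
next
  fix a assume "a \<in> Arr ?S"
  then obtain x m f u y n where a: "a = ((x, m), (f, u), (y, n))"
    and m: "m \<in> Obj (Fib X x)" and n: "n \<in> Obj (Fib X y)"
    and f: "f \<in> hom_set B x y" and u: "u \<in> hom_set (Fib X x) m (FOb (Red X f) n)"
    by (auto simp: grothendieck_def)
  note xy = source.base.hom_obj[OF f]
  interpret x: is_functor "Fib X x" "Fib X' (FOb \<phi> x)" "\<beta> x" by (rule component[OF xy(1)])
  interpret y: is_functor "Fib X y" "Fib X' (FOb \<phi> y)" "\<beta> y" by (rule component[OF xy(2)])
  have "FOb (\<beta> x) (FOb (Red X f) n) = FOb (Red X' (FAr \<phi> f)) (FOb (\<beta> y) n)"
    using natural[OF f] n by (simp add: functor_eq_def functor_comp_def)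
  then show "FAr ?F a \<in> Arr ?T"
    using x.ar_hom[OF u] base.ar_hom[OF f] x.ob[OF m] y.ob[OF n]
    by (simp add: a grothendieck_def grothendieck_map_def)
  show "Src ?T (FAr ?F a) = FOb ?F (Src ?S a)" and "Tgt ?T (FAr ?F a) = FOb ?F (Tgt ?S a)"
    by (simp_all add: a grothendieck_def grothendieck_map_def)
next
  fix a b assume "a \<in> Arr ?S" "b \<in> Arr ?S" "Tgt ?S a = Src ?S b"
  then obtain x m f u y n g v z l where a: "a = ((x, m), (f, u), (y, n))"
    and b: "b = ((y, n), (g, v), (z, l))"
    and f: "f \<in> hom_set B x y" and u: "u \<in> hom_set (Fib X x) m (FOb (Red X f) n)"
    and g: "g \<in> hom_set B y z" and v: "v \<in> hom_set (Fib X y) n (FOb (Red X g) l)"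
    by (auto simp: grothendieck_def)
  have "FAr (\<beta> x) (FAr (Red X f) v) = FAr (Red X' (FAr \<phi> f)) (FAr (\<beta> y) v)"
    using natural[OF f] v by (simp add: functor_eq_def functor_comp_def hom_set_def)
  then show "FAr ?F (Cmp ?S b a) = Cmp ?T (FAr ?F b) (FAr ?F a)"
    using is_functor.cmp_hom[OF component[OF source.base.hom_obj(1)[OF f]] u
        is_functor.ar_hom[OF source.red_hom[OF f] v]]
    by (simp add: a b grothendieck_def grothendieck_map_def base.cmp_hom[OF f g])
qed

section \<open>The category induced by a map into the objects\<close>

definition induced_cat ::
  "('o, 'a) cat \<Rightarrow> 'x set \<Rightarrow> ('x \<Rightarrow> 'o) \<Rightarrow> ('x, 'x \<times> 'a \<times> 'x) cat" where
  "induced_cat C A p = \<lparr>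
     Obj = A,
     Arr = {(x, f, y). x \<in> A \<and> y \<in> A \<and> f \<in> hom_set C (p x) (p y)},
     Src = (\<lambda>(x, _, _). x),
     Tgt = (\<lambda>(_, _, y). y),
     Idn = (\<lambda>x. (x, Idn C (p x), x)),
     Cmp = (\<lambda>(_, g, z) (x, f, _). (x, Cmp C g f, z))\<rparr>"

definition induced_indexed ::
  "('o, 'a, 'm, 'u) indexed \<Rightarrow> ('x \<Rightarrow> 'o) \<Rightarrow> ('x, 'x \<times> 'a \<times> 'x, 'm, 'u) indexed" where
  "induced_indexed X p = \<lparr>Fib = (\<lambda>x. Fib X (p x)), Red = (\<lambda>(_, f, _). Red X f)\<rparr>"

lemma (in category) category_induced_cat:
  assumes "p \<in> A \<rightarrow> Obj C"
  shows "category (induced_cat C A p)"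
proof -
  have "p x \<in> Obj C" if "x \<in> A" for x using assms that by auto
  then show ?thesis
    by unfold_locales
      (auto simp: induced_cat_def idn_hom cmp_hom cmp_idn_hom cmp_assoc_hom)
qed

lemma (in indexed_category) indexed_category_induced:
  assumes "p \<in> A \<rightarrow> Obj B"
  shows "indexed_category (induced_cat B A p) (induced_indexed X p)"
proof -
  interpret ind: category "induced_cat B A p" by (rule base.category_induced_cat[OF assms])
  show ?thesis
    using assms
    by (intro indexed_category.intro indexed_category_axioms.intro ind.category_axioms)
      (auto simp: induced_cat_def induced_indexed_def hom_set_def Pi_iff fib red_idn_ob red_idn_ar
        red_cmp_ob red_cmp_ar intro: red_hom[unfolded hom_set_def])
qed

definition induced_lift ::
  "('p, 'b) cat \<Rightarrow> ('p \<Rightarrow> 'x)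
    \<Rightarrow> ('p, 'b, 'o \<times> 'm, ('o \<times> 'm) \<times> ('a \<times> 'u) \<times> ('o \<times> 'm)) fnctr
    \<Rightarrow> ('p, 'b, 'x \<times> 'm, ('x \<times> 'm) \<times> (('x \<times> 'a \<times> 'x) \<times> 'u) \<times> ('x \<times> 'm)) fnctr" where
  "induced_lift A q U = \<lparr>
     FOb = (\<lambda>a. (q a, snd (FOb U a))),
     FAr = (\<lambda>f. case FAr U f of ((_, m), (g, v), (_, n)) \<Rightarrow>
       ((q (Src A f), m), ((q (Src A f), g, q (Tgt A f)), v), (q (Tgt A f), n)))\<rparr>"

lemma (in indexed_category) is_functor_induced_lift:
  assumes U: "is_functor A (grothendieck B X) U" and p: "p \<in> S \<rightarrow> Obj B"
    and q: "\<And>a. a \<in> Obj A \<Longrightarrow> q a \<in> S" "\<And>a. a \<in> Obj A \<Longrightarrow> fst (FOb U a) = p (q a)"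
  shows "is_functor A (grothendieck (induced_cat B S p) (induced_indexed X p)) (induced_lift A q U)"
    (is "is_functor A ?T ?L")
proof -
  interpret U: is_functor A "grothendieck B X" U by fact
  interpret ind: indexed_category "induced_cat B S p" "induced_indexed X p"
    by (rule indexed_category_induced[OF p])
  show ?thesis
  proof (intro is_functor.intro is_functor_axioms.intro U.src.category_axioms
      ind.category_grothendieck)
    fix a assume a: "a \<in> Obj A"
    show "FOb ?L a \<in> Obj ?T"
      using U.ob[OF a] q[OF a]
      by (auto simp: grothendieck_def induced_cat_def induced_indexed_def induced_lift_def)
    show "FAr ?L (Idn A a) = Idn ?T (FOb ?L a)"
      using U.idn[OF a]
      by (simp add: grothendieck_def induced_cat_def induced_indexed_def induced_lift_def
          U.src.src_idn[OF a] U.src.tgt_idn[OF a] q(2)[OF a] case_prod_unfold)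
  next
    fix f assume f: "f \<in> Arr A"
    have endpoints: "fst (FAr U f) = FOb U (Src A f)" "snd (snd (FAr U f)) = FOb U (Tgt A f)"
      using U.src[OF f] U.tgt[OF f] by (simp_all add: grothendieck_def case_prod_unfold)
    then show "FAr ?L f \<in> Arr ?T"
      using U.ar[OF f] q[OF U.src.src_obj[OF f]] q[OF U.src.tgt_obj[OF f]]
      by (auto simp: grothendieck_def induced_cat_def induced_indexed_def induced_lift_def
          hom_set_def case_prod_unfold)
    show "Src ?T (FAr ?L f) = FOb ?L (Src A f)" and "Tgt ?T (FAr ?L f) = FOb ?L (Tgt A f)"
      using endpoints by (simp_all add: grothendieck_def induced_lift_def case_prod_unfold)
  next
    fix f g assume fg: "f \<in> Arr A" "g \<in> Arr A" "Tgt A f = Src A g"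
    show "FAr ?L (Cmp A g f) = Cmp ?T (FAr ?L g) (FAr ?L f)"
      using U.src[OF fg(1)]
      by (simp add: U.cmp[OF fg] U.src.src_cmp[OF fg] U.src.tgt_cmp[OF fg] grothendieck_def
          induced_cat_def induced_indexed_def induced_lift_def case_prod_unfold)
        (simp add: q(2) U.src.src_obj[OF fg(1)])
  qed
qed

section \<open>Transfer along a fully faithful functor\<close>

definition preimage_arrow ::
  "('o1, 'a1) cat \<Rightarrow> ('o1, 'a1, 'o2, 'a2) fnctr \<Rightarrow> 'o1 \<Rightarrow> 'o1 \<Rightarrow> 'a2 \<Rightarrow> 'a1" where
  "preimage_arrow C F x y = inv_into (hom_set C x y) (FAr F)"

lemma preimage_arrow:
  assumes "fully_faithful C D F" "x \<in> Obj C" "y \<in> Obj C"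
    and "h \<in> hom_set D (FOb F x) (FOb F y)"
  shows preimage_arrow_hom: "preimage_arrow C F x y h \<in> hom_set C x y"
    and FAr_preimage_arrow: "FAr F (preimage_arrow C F x y h) = h"
proof -
  have "h \<in> FAr F ` hom_set C x y"
    using assms by (auto simp: fully_faithful_def bij_betw_def)
  then show "preimage_arrow C F x y h \<in> hom_set C x y" "FAr F (preimage_arrow C F x y h) = h"
    unfolding preimage_arrow_def by (rule inv_into_into, rule f_inv_into_f)
qed

lemma preimage_arrow_eqI:
  assumes "fully_faithful C D F" "x \<in> Obj C" "y \<in> Obj C"
    and "f \<in> hom_set C x y" "FAr F f = h"
  shows "preimage_arrow C F x y h = f"
  using assms unfolding preimage_arrow_def fully_faithful_def bij_betw_def
  by (auto intro: inv_into_f_eq)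

locale fully_faithful_transfer = is_functor C D F
  for C :: "('o1, 'a1) cat" and D :: "('o2, 'a2) cat" and F :: "('o1, 'a1, 'o2, 'a2) fnctr" +
  fixes A :: "'x set" and t :: "'x \<Rightarrow> 'o1" and p :: "'x \<Rightarrow> 'o2" and i :: "'x \<Rightarrow> 'a2"
  assumes fully_faithful: "fully_faithful C D F"
    and t_obj: "x \<in> A \<Longrightarrow> t x \<in> Obj C"
    and i_hom: "x \<in> A \<Longrightarrow> i x \<in> hom_set D (FOb F (t x)) (p x)"
    and iso_i: "x \<in> A \<Longrightarrow> iso_arrow D (i x)"
begin

abbreviation i_inv :: "'x \<Rightarrow> 'a2" where
  "i_inv x \<equiv> inv_arrow D (i x)"

lemma i_inv_hom: "x \<in> A \<Longrightarrow> i_inv x \<in> hom_set D (p x) (FOb F (t x))"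
  and i_inv_i: "x \<in> A \<Longrightarrow> Cmp D (i_inv x) (i x) = Idn D (FOb F (t x))"
  and i_i_inv: "x \<in> A \<Longrightarrow> Cmp D (i x) (i_inv x) = Idn D (p x)"
  using tgt.inv_arrow[OF iso_i, of x] i_hom[of x]
  by (auto simp: inverse_arrows_def hom_set_def)

definition transfer :: "'x \<Rightarrow> 'x \<Rightarrow> 'a2 \<Rightarrow> 'a1" where
  "transfer x y g = preimage_arrow C F (t x) (t y) (Cmp D (i_inv y) (Cmp D g (i x)))"

lemma conjugate_hom:
  assumes "x \<in> A" "y \<in> A" "g \<in> hom_set D (p x) (p y)"
  shows "Cmp D (i_inv y) (Cmp D g (i x)) \<in> hom_set D (FOb F (t x)) (FOb F (t y))"
  using assms tgt.cmp_hom i_hom i_inv_hom by metis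

lemma transfer_hom:
  assumes "x \<in> A" "y \<in> A" "g \<in> hom_set D (p x) (p y)"
  shows "transfer x y g \<in> hom_set C (t x) (t y)"
  unfolding transfer_def using assms
  by (intro preimage_arrow_hom[OF fully_faithful] t_obj conjugate_hom)

lemma FAr_transfer_i_inv:
  assumes x: "x \<in> A" and y: "y \<in> A" and g: "g \<in> hom_set D (p x) (p y)"
  shows "Cmp D (FAr F (transfer x y g)) (i_inv x) = Cmp D (i_inv y) g"
proof -
  have "Cmp D (FAr F (transfer x y g)) (i_inv x)
      = Cmp D (Cmp D (i_inv y) (Cmp D g (i x))) (i_inv x)"
    by (simp add: transfer_def FAr_preimage_arrow[OF fully_faithful t_obj[OF x] t_obj[OF y]
          conjugate_hom[OF x y g]])
  also have "\<dots> = Cmp D (i_inv y) (Cmp D g (Cmp D (i x) (i_inv x)))"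
    by (simp add: tgt.cmp_assoc_hom[OF i_inv_hom[OF x] tgt.cmp_hom[OF i_hom[OF x] g]
          i_inv_hom[OF y]] tgt.cmp_assoc_hom[OF i_inv_hom[OF x] i_hom[OF x] g])
  also have "\<dots> = Cmp D (i_inv y) g"
    by (simp add: i_i_inv[OF x] tgt.cmp_idn_hom[OF g])
  finally show ?thesis .
qed

lemma transfer_eqI:
  assumes x: "x \<in> A" and y: "y \<in> A" and g: "g \<in> hom_set D (p x) (p y)"
    and h: "h \<in> hom_set C (t x) (t y)" and eq: "Cmp D (FAr F h) (i_inv x) = Cmp D (i_inv y) g"
  shows "transfer x y g = h"
proof -
  note Fh = ar_hom[OF h]
  have "Cmp D (i_inv y) (Cmp D g (i x)) = Cmp D (Cmp D (FAr F h) (i_inv x)) (i x)"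
    by (simp add: eq tgt.cmp_assoc_hom[OF i_hom[OF x] g i_inv_hom[OF y]])
  also have "\<dots> = FAr F h"
    by (simp add: tgt.cmp_assoc_hom[OF i_hom[OF x] i_inv_hom[OF x] Fh] i_inv_i[OF x]
        tgt.cmp_idn_hom[OF Fh])
  finally show ?thesis
    unfolding transfer_def
    by (intro preimage_arrow_eqI[OF fully_faithful t_obj[OF x] t_obj[OF y] h]) simp
qed

lemma transfer_idn:
  assumes x: "x \<in> A"
  shows "transfer x x (Idn D (p x)) = Idn C (t x)"
  using tgt.cmp_idn_hom[OF i_inv_hom[OF x]] tgt.hom_obj(2)[OF i_hom[OF x]] t_obj[OF x]
  by (intro transfer_eqI[OF x x]) (simp_all add: idn src.idn_hom tgt.idn_hom)

lemma transfer_cmp: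
  assumes x: "x \<in> A" and y: "y \<in> A" and z: "z \<in> A"
    and g: "g \<in> hom_set D (p x) (p y)" and h: "h \<in> hom_set D (p y) (p z)"
  shows "transfer x z (Cmp D h g) = Cmp C (transfer y z h) (transfer x y g)"
proof (rule transfer_eqI[OF x z tgt.cmp_hom[OF g h]])
  note g' = transfer_hom[OF x y g] and h' = transfer_hom[OF y z h]
  show "Cmp C (transfer y z h) (transfer x y g) \<in> hom_set C (t x) (t z)"
    by (rule src.cmp_hom[OF g' h'])
  have "Cmp D (FAr F (Cmp C (transfer y z h) (transfer x y g))) (i_inv x)
      = Cmp D (FAr F (transfer y z h)) (Cmp D (FAr F (transfer x y g)) (i_inv x))"
    by (simp add: cmp_hom[OF g' h']
        tgt.cmp_assoc_hom[OF i_inv_hom[OF x] ar_hom[OF g'] ar_hom[OF h']])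
  also have "\<dots> = Cmp D (Cmp D (FAr F (transfer y z h)) (i_inv y)) g"
    by (simp add: FAr_transfer_i_inv[OF x y g]
        tgt.cmp_assoc_hom[OF g i_inv_hom[OF y] ar_hom[OF h']])
  also have "\<dots> = Cmp D (i_inv z) (Cmp D h g)"
    by (simp add: FAr_transfer_i_inv[OF y z h] tgt.cmp_assoc_hom[OF g h i_inv_hom[OF z]])
  finally show "Cmp D (FAr F (Cmp C (transfer y z h) (transfer x y g))) (i_inv x)
    = Cmp D (i_inv z) (Cmp D h g)" .
qed

end

section \<open>Institutions and skolemizations\<close>

lemma (in is_institution) sen_map_hom:
  "\<lbrakk>h \<in> hom_set (Sig I) x y; \<psi> \<in> Sen I x\<rbrakk> \<Longrightarrow> SenMap I h \<psi> \<in> Sen I y"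
  using sen_map[of h] by (auto simp: hom_set_def)

lemma (in is_institution) sen_cmp_hom:
  "\<lbrakk>f \<in> hom_set (Sig I) x y; g \<in> hom_set (Sig I) y z; \<psi> \<in> Sen I x\<rbrakk>
    \<Longrightarrow> SenMap I (Cmp (Sig I) g f) \<psi> = SenMap I g (SenMap I f \<psi>)"
  by (auto simp: hom_set_def sen_cmp)

lemma (in is_institution) satisfies_all_SenMap_image:
  assumes "h \<in> hom_set (Sig I) x y" "m \<in> Obj (Models I y)" "E \<subseteq> Sen I x"
  shows "satisfies_all I (y, SenMap I h ` E) m \<longleftrightarrow> satisfies_all I (x, E) (reduct I h m)"
  using satisfaction[OF assms(1,2)] assms(3) by (auto simp: satisfies_all_def)

lemma (in is_institution) mem_hom_set_Pres_iff:
  "a \<in> hom_set (Pres I) P Q \<longleftrightarrow>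
     (\<exists>h. a = (P, h, Q) \<and> P \<in> Obj (Pres I) \<and> Q \<in> Obj (Pres I) \<and>
       h \<in> hom_set (Sig I) (fst P) (fst Q) \<and> SenMap I h ` snd P \<subseteq> snd Q)"
  using base.src_obj base.tgt_obj
  by (cases P; cases Q) (auto simp: hom_set_def Pres_def)

sublocale institution_morphism \<subseteq> models: indexed_functor "Sig J" "Mod J" "Sig I" "Mod I" \<phi> \<beta>
proof (intro indexed_functor.intro indexed_functor_axioms.intro J.indexed_category_axioms
    I.indexed_category_axioms sig.is_functor_axioms mod)
  fix h x y assume "h \<in> hom_set (Sig J) x y"
  then show "functor_eq (Models J y) (functor_comp (\<beta> x) (Red (Mod J) h))
      (functor_comp (Red (Mod I) (FAr \<phi> h)) (\<beta> y))"
    by (simp add: functor_eq_def functor_comp_def mod_natural_ob mod_natural_ar)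
qed

context institution_morphism
begin

lemma \<beta>_ob: "\<lbrakk>x \<in> Obj (Sig J); m \<in> Obj (Models J x)\<rbrakk>
    \<Longrightarrow> FOb (\<beta> x) m \<in> Obj (Models I (FOb \<phi> x))"
  using mod by (rule is_functor.ob)

lemma satisfies_all_\<alpha>_image:
  assumes "x \<in> Obj (Sig J)" "m \<in> Obj (Models J x)" "E \<subseteq> Sen I (FOb \<phi> x)"
  shows "satisfies_all J (x, \<alpha> x ` E) m \<longleftrightarrow> satisfies_all I (FOb \<phi> x, E) (FOb (\<beta> x) m)"
  using sat[OF assms(1,2)] assms(3) by (auto simp: satisfies_all_def)

lemma model_star_reflect:
  assumes x: "x \<in> Obj (Sig J)" and m: "m \<in> Obj (Models J x)" and n: "n \<in> Obj (Models J x)"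
    and surj: "semantically_surjective J x (Sen I (FOb \<phi> x)) (\<alpha> x)"
    and star_eq: "model_star I (FOb \<phi> x) (FOb (\<beta> x) m) = model_star I (FOb \<phi> x) (FOb (\<beta> x) n)"
  shows "model_star J x m = model_star J x n"
proof -
  have "Sat J x m s \<longleftrightarrow> Sat J x n s" if s: "s \<in> Sen J x" for s
  proof -
    obtain r where r: "r \<in> Sen I (FOb \<phi> x)" "sentence_star J x s = sentence_star J x (\<alpha> x r)"
      using surj s by (auto simp: semantically_surjective_def)
    have "Sat J x k s \<longleftrightarrow> r \<in> model_star I (FOb \<phi> x) (FOb (\<beta> x) k)"
      if k: "k \<in> Obj (Models J x)" for k
      using r k sat[OF x k r(1)] by (auto simp: sentence_star_def model_star_def)
    then show ?thesis using m n star_eq by simp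
  qed
  then show ?thesis by (auto simp: model_star_def)
qed

end

context skolemization
begin

lemma SkPres_sen: "x \<in> Obj (Sig I) \<Longrightarrow> snd (SkPres K x) \<subseteq> Sen I (SkSig K x)"
  using sk_pres[of x] by (auto simp: Pres_def SkSig_def)

lemma skolemization_of_SkMod:
  assumes "x \<in> Obj (Sig I)" "m \<in> Obj (Models I x)"
  shows "skolemization_of I K x (SkMod K x m) m"
proof -
  have "FOb (SkFun K) (x, m) \<in> Obj (grothendieck (Pres I) (ModPres I))"
    using assms is_functor.ob[OF sk_functor] by (simp add: grothendieck_def)
  then have "SkMod K x m \<in> Obj (Fib (ModPres I) (SkPres K x))"
    using sk_functor_pres[OF assms] by (auto simp: grothendieck_def SkMod_def)
  then show ?thesis
    using sk_reduct[OF assms]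
    by (simp add: skolemization_of_def ModPres_def full_subcat_def SkSig_def)
qed

end

section \<open>The transferred skolemization\<close>

locale skolem_transfer = institution_morphism J I \<phi> \<alpha> \<beta> + sk: skolemization I K
  for I :: "('o1, 'a1, 's1, 'm1, 'u1) institution"
    and J :: "('o2, 'a2, 's2, 'm2, 'u2) institution"
    and K :: "('o1, 'a1, 's1, 'm1, 'u1) skolem"
    and \<phi> :: "('o2, 'a2, 'o1, 'a1) fnctr"
    and \<alpha> :: "'o2 \<Rightarrow> 's1 \<Rightarrow> 's2"
    and \<beta> :: "'o2 \<Rightarrow> ('m2, 'u2, 'm1, 'u1) fnctr" +
  fixes til :: "'o2 \<Rightarrow> 'o2"
    and i :: "'o2 \<Rightarrow> 'a1"
  assumes fully_faithful_\<phi>: "fully_faithful (Sig J) (Sig I) \<phi>"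
    and til_obj: "x \<in> Obj (Sig J) \<Longrightarrow> til x \<in> Obj (Sig J)"
    and i_hom: "x \<in> Obj (Sig J) \<Longrightarrow> i x \<in> hom_set (Sig I) (FOb \<phi> (til x)) (SkSig K (FOb \<phi> x))"
    and iso_i: "x \<in> Obj (Sig J) \<Longrightarrow> iso_arrow (Sig I) (i x)"
    and iso_\<beta>: "x \<in> Obj (Sig J) \<Longrightarrow> iso_of_categories (Models J x) (Models I (FOb \<phi> x)) (\<beta> x)"
    and surj_\<alpha>: "x \<in> Obj (Sig J) \<Longrightarrow> semantically_surjective J x (Sen I (FOb \<phi> x)) (\<alpha> x)"
begin

abbreviation skolem_sig :: "'o2 \<Rightarrow> 'o1" where
  "skolem_sig x \<equiv> SkSig K (FOb \<phi> x)"

abbreviation skolem_pres :: "'o2 \<Rightarrow> 'o1 \<times> 's1 set" where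
  "skolem_pres x \<equiv> SkPres K (FOb \<phi> x)"

sublocale skolem_sig: fully_faithful_transfer "Sig J" "Sig I" \<phi> "Obj (Sig J)" til skolem_sig i
  by unfold_locales (simp_all add: fully_faithful_\<phi> til_obj i_hom iso_i)

subsection \<open>Models and sentences\<close>

definition model_transfer :: "'o2 \<Rightarrow> ('m1, 'u1, 'm2, 'u2) fnctr" where
  "model_transfer x =
     functor_comp (inv_functor (Models J (til x)) (\<beta> (til x))) (Red (Mod I) (i x))"

definition model_transfer_inv :: "'o2 \<Rightarrow> ('m2, 'u2, 'm1, 'u1) fnctr" where
  "model_transfer_inv x = functor_comp (Red (Mod I) (skolem_sig.i_inv x)) (\<beta> (til x))"

lemma inverse_functors_\<beta>:
  "x \<in> Obj (Sig J) \<Longrightarrow> inverse_functors (Models J x) (Models I (FOb \<phi> x)) (\<beta> x)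
    (inv_functor (Models J x) (\<beta> x))"
  by (rule inverse_functors_inv_functor[OF iso_\<beta>])

lemma inverse_functors_model_transfer:
  assumes x: "x \<in> Obj (Sig J)"
  shows "inverse_functors (Models I (skolem_sig x)) (Models J (til x))
    (model_transfer x) (model_transfer_inv x)"
  unfolding model_transfer_def model_transfer_inv_def
  using I.inverse_functors_Red[OF I.base.inv_arrow[OF iso_i[OF x]] i_hom[OF x]]
    inverse_functors_sym[OF inverse_functors_\<beta>[OF til_obj[OF x]]]
  by (rule inverse_functors_comp)

context
  fixes x y g
  assumes x: "x \<in> Obj (Sig J)" and y: "y \<in> Obj (Sig J)"
    and g: "g \<in> hom_set (Sig I) (skolem_sig x) (skolem_sig y)"
begin

lemma model_transfer_inv_natural:
  "functor_eq (Models J (til y))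
     (functor_comp (model_transfer_inv x) (Red (Mod J) (skolem_sig.transfer x y g)))
     (functor_comp (Red (Mod I) g) (model_transfer_inv y))"
proof -
  let ?h = "skolem_sig.transfer x y g" and ?Red = "Red (Mod I)"
  note h = skolem_sig.transfer_hom[OF x y g]
  note i_inv_x = skolem_sig.i_inv_hom[OF x] and i_inv_y = skolem_sig.i_inv_hom[OF y]
  note \<beta>_functor = mod[OF til_obj[OF y]]
  have "functor_eq (Models J (til y)) (functor_comp (model_transfer_inv x) (Red (Mod J) ?h))
      (functor_comp (?Red (skolem_sig.i_inv x)) (functor_comp (?Red (FAr \<phi> ?h)) (\<beta> (til y))))"
    unfolding model_transfer_inv_def functor_comp_assoc
    by (rule functor_eq_comp_left[OF models.natural[OF h]])
  also have "functor_eq (Models J (til y)) \<dots>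
      (functor_comp (?Red (Cmp (Sig I) (FAr \<phi> ?h) (skolem_sig.i_inv x))) (\<beta> (til y)))"
    unfolding functor_comp_assoc[symmetric]
    by (rule functor_eq_comp_right[OF \<beta>_functor
          functor_eq_sym[OF I.red_cmp[OF i_inv_x sig.ar_hom[OF h]]]])
  also have "functor_eq (Models J (til y)) \<dots> (functor_comp (?Red g) (model_transfer_inv y))"
    unfolding model_transfer_inv_def functor_comp_assoc[symmetric]
      skolem_sig.FAr_transfer_i_inv[OF x y g]
    by (rule functor_eq_comp_right[OF \<beta>_functor I.red_cmp[OF g i_inv_y]])
  finally show ?thesis .
qed

lemma model_transfer_natural:
  "functor_eq (Models I (skolem_sig y)) (functor_comp (model_transfer x) (Red (Mod I) g))
     (functor_comp (Red (Mod J) (skolem_sig.transfer x y g)) (model_transfer y))"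
  by (rule inverse_functors_natural[OF inverse_functors_model_transfer[OF y]
        inverse_functors_model_transfer[OF x] J.red_hom[OF skolem_sig.transfer_hom[OF x y g]]
        model_transfer_inv_natural])

lemma SenMap_transfer:
  assumes s: "s \<in> Sen I (skolem_sig x)"
  shows "SenMap J (skolem_sig.transfer x y g) (\<alpha> (til x) (SenMap I (skolem_sig.i_inv x) s))
    = \<alpha> (til y) (SenMap I (skolem_sig.i_inv y) (SenMap I g s))"
proof -
  let ?h = "skolem_sig.transfer x y g"
  note h = skolem_sig.transfer_hom[OF x y g]
  note i_inv_x = skolem_sig.i_inv_hom[OF x] and i_inv_y = skolem_sig.i_inv_hom[OF y]
  have "SenMap J ?h (\<alpha> (til x) (SenMap I (skolem_sig.i_inv x) s))
      = \<alpha> (til y) (SenMap I (FAr \<phi> ?h) (SenMap I (skolem_sig.i_inv x) s))"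
    by (rule sen_natural[OF h I.sen_map_hom[OF i_inv_x s], symmetric])
  also have "SenMap I (FAr \<phi> ?h) (SenMap I (skolem_sig.i_inv x) s)
      = SenMap I (Cmp (Sig I) (FAr \<phi> ?h) (skolem_sig.i_inv x)) s"
    by (rule I.sen_cmp_hom[OF i_inv_x sig.ar_hom[OF h] s, symmetric])
  also have "\<dots> = SenMap I (skolem_sig.i_inv y) (SenMap I g s)"
    unfolding skolem_sig.FAr_transfer_i_inv[OF x y g] by (rule I.sen_cmp_hom[OF g i_inv_y s])
  finally show ?thesis .
qed

end

subsection \<open>Presentations\<close>

definition pres_transfer :: "'o2 \<Rightarrow> 'o2 \<times> 's2 set" where
  "pres_transfer x =
     (til x, \<alpha> (til x) ` SenMap I (skolem_sig.i_inv x) ` snd (skolem_pres x))"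

lemma fst_pres_transfer [simp]: "fst (pres_transfer x) = til x"
  by (simp add: pres_transfer_def)

lemma SenMap_i_inv_subset:
  assumes x: "x \<in> Obj (Sig J)"
  shows "SenMap I (skolem_sig.i_inv x) ` snd (skolem_pres x) \<subseteq> Sen I (FOb \<phi> (til x))"
  using I.sen_map_hom[OF skolem_sig.i_inv_hom[OF x]] sk.SkPres_sen[OF sig.ob[OF x]] by blast

lemma pres_transfer_obj:
  assumes x: "x \<in> Obj (Sig J)"
  shows "pres_transfer x \<in> Obj (Pres J)"
  using sen[OF til_obj[OF x]] SenMap_i_inv_subset[OF x] til_obj[OF x]
  by (fastforce simp: Pres_def pres_transfer_def)

lemma satisfies_all_pres_transfer:
  assumes x: "x \<in> Obj (Sig J)" and m: "m \<in> Obj (Models J (til x))"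
  shows "satisfies_all J (pres_transfer x) m
    \<longleftrightarrow> satisfies_all I (skolem_pres x) (FOb (model_transfer_inv x) m)"
  using satisfies_all_\<alpha>_image[OF til_obj[OF x] m SenMap_i_inv_subset[OF x]]
    I.satisfies_all_SenMap_image[OF skolem_sig.i_inv_hom[OF x] \<beta>_ob[OF til_obj[OF x] m]
      sk.SkPres_sen[OF sig.ob[OF x]]]
  by (simp add: pres_transfer_def model_transfer_inv_def functor_comp_def SkSig_def)

lemma pres_transfer_hom:
  assumes x: "x \<in> Obj (Sig J)" and y: "y \<in> Obj (Sig J)"
    and g: "(skolem_pres x, g, skolem_pres y) \<in> hom_set (Pres I) (skolem_pres x) (skolem_pres y)"
  shows "(pres_transfer x, skolem_sig.transfer x y g, pres_transfer y)
    \<in> hom_set (Pres J) (pres_transfer x) (pres_transfer y)"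
proof -
  have g': "g \<in> hom_set (Sig I) (skolem_sig x) (skolem_sig y)"
    and gE: "SenMap I g ` snd (skolem_pres x) \<subseteq> snd (skolem_pres y)"
    using g by (simp_all add: I.mem_hom_set_Pres_iff SkSig_def)
  have "SenMap J (skolem_sig.transfer x y g) ` snd (pres_transfer x)
      = \<alpha> (til y) ` SenMap I (skolem_sig.i_inv y) ` SenMap I g ` snd (skolem_pres x)"
    unfolding pres_transfer_def snd_conv image_image
    using SenMap_transfer[OF x y g'] sk.SkPres_sen[OF sig.ob[OF x]]
    by (intro image_cong) auto
  also have "\<dots> \<subseteq> snd (pres_transfer y)"
    using gE by (simp add: pres_transfer_def image_mono)
  finally show ?thesis
    using skolem_sig.transfer_hom[OF x y g'] pres_transfer_obj[OF x] pres_transfer_obj[OF y]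
    by (simp add: J.mem_hom_set_Pres_iff)
qed

abbreviation skolem_pres_cat ::
  "('o2, 'o2 \<times> (('o1 \<times> 's1 set) \<times> 'a1 \<times> ('o1 \<times> 's1 set)) \<times> 'o2) cat" where
  "skolem_pres_cat \<equiv> induced_cat (Pres I) (Obj (Sig J)) skolem_pres"

definition pres_functor ::
  "('o2, 'o2 \<times> (('o1 \<times> 's1 set) \<times> 'a1 \<times> ('o1 \<times> 's1 set)) \<times> 'o2,
    'o2 \<times> 's2 set, ('o2 \<times> 's2 set) \<times> 'a2 \<times> ('o2 \<times> 's2 set)) fnctr" where
  "pres_functor = \<lparr>
     FOb = pres_transfer,
     FAr = (\<lambda>(x, (_, g, _), y). (pres_transfer x, skolem_sig.transfer x y g, pres_transfer y))\<rparr>"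

lemma skolem_pres_obj: "skolem_pres \<in> Obj (Sig J) \<rightarrow> Obj (Pres I)"
  by (simp add: sk.sk_pres sig.ob)

lemma skolem_pres_cat_arE:
  assumes "a \<in> Arr skolem_pres_cat"
  obtains x g y where "a = (x, (skolem_pres x, g, skolem_pres y), y)"
    and "x \<in> Obj (Sig J)" and "y \<in> Obj (Sig J)"
    and "g \<in> hom_set (Sig I) (skolem_sig x) (skolem_sig y)"
    and "(skolem_pres x, g, skolem_pres y) \<in> hom_set (Pres I) (skolem_pres x) (skolem_pres y)"
  using assms that by (auto simp: induced_cat_def I.mem_hom_set_Pres_iff SkSig_def)

lemma is_functor_pres_functor: "is_functor skolem_pres_cat (Pres J) pres_functor"
proof (intro is_functor.intro is_functor_axioms.intro J.category_Pres
    category.category_induced_cat[OF I.category_Pres skolem_pres_obj])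
  fix x assume "x \<in> Obj skolem_pres_cat"
  then have x: "x \<in> Obj (Sig J)" by (simp add: induced_cat_def)
  show "FOb pres_functor x \<in> Obj (Pres J)"
    by (simp add: pres_functor_def pres_transfer_obj[OF x])
  show "FAr pres_functor (Idn skolem_pres_cat x) = Idn (Pres J) (FOb pres_functor x)"
    using skolem_sig.transfer_idn[OF x]
    by (simp add: pres_functor_def induced_cat_def Pres_def SkSig_def)
next
  fix a assume "a \<in> Arr skolem_pres_cat"
  then obtain x g y where a: "a = (x, (skolem_pres x, g, skolem_pres y), y)"
    and xy: "x \<in> Obj (Sig J)" "y \<in> Obj (Sig J)"
    and g: "(skolem_pres x, g, skolem_pres y) \<in> hom_set (Pres I) (skolem_pres x) (skolem_pres y)"
    by (rule skolem_pres_cat_arE)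
  show "FAr pres_functor a \<in> Arr (Pres J)"
    using pres_transfer_hom[OF xy g] by (simp add: a pres_functor_def hom_set_def)
  show "Src (Pres J) (FAr pres_functor a) = FOb pres_functor (Src skolem_pres_cat a)"
    and "Tgt (Pres J) (FAr pres_functor a) = FOb pres_functor (Tgt skolem_pres_cat a)"
    by (simp_all add: a pres_functor_def induced_cat_def Pres_def)
next
  fix a b assume a_arr: "a \<in> Arr skolem_pres_cat" and b_arr: "b \<in> Arr skolem_pres_cat"
    and composable: "Tgt skolem_pres_cat a = Src skolem_pres_cat b"
  obtain x g y where a: "a = (x, (skolem_pres x, g, skolem_pres y), y)"
    and xy: "x \<in> Obj (Sig J)" "y \<in> Obj (Sig J)"
    and g: "g \<in> hom_set (Sig I) (skolem_sig x) (skolem_sig y)"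
    using a_arr by (rule skolem_pres_cat_arE)
  obtain h z where b: "b = (y, (skolem_pres y, h, skolem_pres z), z)"
    and z: "z \<in> Obj (Sig J)" and h: "h \<in> hom_set (Sig I) (skolem_sig y) (skolem_sig z)"
    using b_arr composable by (elim skolem_pres_cat_arE) (simp add: a induced_cat_def)
  show "FAr pres_functor (Cmp skolem_pres_cat b a)
      = Cmp (Pres J) (FAr pres_functor b) (FAr pres_functor a)"
    by (simp add: a b pres_functor_def induced_cat_def Pres_def
        skolem_sig.transfer_cmp[OF xy z g h])
qed

lemma indexed_functor_model_transfer:
  "indexed_functor skolem_pres_cat (induced_indexed (ModPres I) skolem_pres) (Pres J) (ModPres J)
     pres_functor model_transfer"
proof (intro indexed_functor.intro indexed_functor_axioms.intro is_functor_pres_functor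
    J.indexed_category_ModPres
    indexed_category.indexed_category_induced[OF I.indexed_category_ModPres skolem_pres_obj])
  fix x assume "x \<in> Obj skolem_pres_cat"
  then have x: "x \<in> Obj (Sig J)" by (simp add: induced_cat_def)
  interpret T: inverse_functor_pair "Models I (skolem_sig x)" "Models J (til x)"
      "model_transfer x" "model_transfer_inv x"
    by unfold_locales (rule inverse_functors_model_transfer[OF x])
  have "is_functor (full_subcat (Models I (skolem_sig x)) (satisfies_all I (skolem_pres x)))
      (full_subcat (Models J (til x)) (satisfies_all J (pres_transfer x))) (model_transfer x)"
    by (rule is_functor_full_subcat[OF T.F.is_functor_axioms])
      (simp add: satisfies_all_pres_transfer[OF x T.F.ob] T.GF_ob)
  then show "is_functor (Fib (induced_indexed (ModPres I) skolem_pres) x)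
      (Fib (ModPres J) (FOb pres_functor x)) (model_transfer x)"
    by (simp add: induced_indexed_def ModPres_def pres_functor_def SkSig_def)
next
  fix a x y assume "a \<in> hom_set skolem_pres_cat x y"
  then have ar: "a \<in> Arr skolem_pres_cat" "Src skolem_pres_cat a = x" "Tgt skolem_pres_cat a = y"
    by (simp_all add: hom_set_def)
  obtain g where a: "a = (x, (skolem_pres x, g, skolem_pres y), y)"
    and xy: "x \<in> Obj (Sig J)" "y \<in> Obj (Sig J)"
    and g: "g \<in> hom_set (Sig I) (skolem_sig x) (skolem_sig y)"
    using ar by (elim skolem_pres_cat_arE) (simp add: induced_cat_def)
  show "functor_eq (Fib (induced_indexed (ModPres I) skolem_pres) y)
      (functor_comp (model_transfer x) (Red (induced_indexed (ModPres I) skolem_pres) a))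
      (functor_comp (Red (ModPres J) (FAr pres_functor a)) (model_transfer y))"
    using model_transfer_natural[OF xy g]
    by (simp add: a induced_indexed_def ModPres_def pres_functor_def functor_eq_def
        full_subcat_def SkSig_def)
qed

subsection \<open>Skolemizations\<close>

text \<open>Distinct signatures of \<open>J\<close> may share a Skolem presentation in \<open>I\<close>, so the given Skolem functor
  is first lifted to the category induced by \<open>skolem_pres\<close>, whose objects remember the signature.\<close>

definition skolem_functor ::
  "('o2 \<times> 'm2, ('o2 \<times> 'm2) \<times> ('a2 \<times> 'u2) \<times> ('o2 \<times> 'm2),
    ('o2 \<times> 's2 set) \<times> 'm2,
    (('o2 \<times> 's2 set) \<times> 'm2) \<times> ((('o2 \<times> 's2 set) \<times> 'a2 \<times> ('o2 \<times> 's2 set)) \<times> 'u2)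
      \<times> (('o2 \<times> 's2 set) \<times> 'm2)) fnctr" where
  "skolem_functor = functor_comp (grothendieck_map pres_functor model_transfer)
     (induced_lift (grothendieck (Sig J) (Mod J)) fst
       (functor_comp (SkFun K) (grothendieck_map \<phi> \<beta>)))"

lemma is_functor_skolem_functor:
  "is_functor (grothendieck (Sig J) (Mod J)) (grothendieck (Pres J) (ModPres J)) skolem_functor"
  unfolding skolem_functor_def
proof (rule is_functor_functor_comp[OF indexed_category.is_functor_induced_lift])
  show "indexed_category (Pres I) (ModPres I)" by (rule I.indexed_category_ModPres)
  show "is_functor (grothendieck (Sig J) (Mod J)) (grothendieck (Pres I) (ModPres I))
      (functor_comp (SkFun K) (grothendieck_map \<phi> \<beta>))"
    by (rule is_functor_functor_comp[OF models.is_functor_grothendieck_map sk.sk_functor])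
  show "skolem_pres \<in> Obj (Sig J) \<rightarrow> Obj (Pres I)" by (rule skolem_pres_obj)
  fix a assume "a \<in> Obj (grothendieck (Sig J) (Mod J))"
  then show "fst a \<in> Obj (Sig J)"
    and "fst (FOb (functor_comp (SkFun K) (grothendieck_map \<phi> \<beta>)) a) = skolem_pres (fst a)"
    by (auto simp: grothendieck_def functor_comp_def grothendieck_map_def sig.ob \<beta>_ob
        sk.sk_functor_pres)
qed (rule indexed_functor.is_functor_grothendieck_map[OF indexed_functor_model_transfer])

lemma FOb_skolem_functor:
  "FOb skolem_functor (x, m) =
     (pres_transfer x, FOb (model_transfer x) (SkMod K (FOb \<phi> x) (FOb (\<beta> x) m)))"
  by (simp add: skolem_functor_def functor_comp_def induced_lift_def grothendieck_map_def
      pres_functor_def SkMod_def)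

definition tau_transfer :: "'o2 \<Rightarrow> 'a2" where
  "tau_transfer x = preimage_arrow (Sig J) \<phi> x (til x)
     (Cmp (Sig I) (skolem_sig.i_inv x) (SkTau K (FOb \<phi> x)))"

lemma tau_transfer_hom: "x \<in> Obj (Sig J) \<Longrightarrow> tau_transfer x \<in> hom_set (Sig J) x (til x)"
  and FAr_tau_transfer: "x \<in> Obj (Sig J) \<Longrightarrow> FAr \<phi> (tau_transfer x)
    = Cmp (Sig I) (skolem_sig.i_inv x) (SkTau K (FOb \<phi> x))"
proof -
  assume x: "x \<in> Obj (Sig J)"
  note preimage = preimage_arrow[OF fully_faithful_\<phi> x til_obj[OF x]
      I.base.cmp_hom[OF sk.sk_tau[OF sig.ob[OF x]] skolem_sig.i_inv_hom[OF x]]]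
  show "tau_transfer x \<in> hom_set (Sig J) x (til x)"
    and "FAr \<phi> (tau_transfer x) = Cmp (Sig I) (skolem_sig.i_inv x) (SkTau K (FOb \<phi> x))"
    unfolding tau_transfer_def by (fact preimage)+
qed

lemma tau_transfer_unique:
  assumes "x \<in> Obj (Sig J)" "t \<in> hom_set (Sig J) x (til x)"
    and "FAr \<phi> t = Cmp (Sig I) (skolem_sig.i_inv x) (SkTau K (FOb \<phi> x))"
  shows "t = tau_transfer x"
  unfolding tau_transfer_def
  using preimage_arrow_eqI[OF fully_faithful_\<phi> _ til_obj] assms by metis

lemma \<beta>_reduct_tau_transfer:
  assumes x: "x \<in> Obj (Sig J)" and m: "m \<in> Obj (Models J (til x))"
  shows "FOb (\<beta> x) (reduct J (tau_transfer x) m)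
    = reduct I (SkTau K (FOb \<phi> x)) (FOb (model_transfer_inv x) m)"
  using I.red_cmp[OF sk.sk_tau[OF sig.ob[OF x]] skolem_sig.i_inv_hom[OF x]]
    \<beta>_ob[OF til_obj[OF x] m]
  by (simp add: mod_natural_ob[OF tau_transfer_hom[OF x] m] FAr_tau_transfer[OF x]
      model_transfer_inv_def functor_comp_def functor_eq_def)

definition transferred_skolem :: "('o2, 'a2, 's2, 'm2, 'u2) skolem" where
  "transferred_skolem = \<lparr>
     SkFun = skolem_functor,
     SkPres = pres_transfer,
     SkIncl = (\<lambda>x. map_prod (image (FAr (model_transfer x))) (image (FAr (model_transfer x)))
       (SkIncl K (FOb \<phi> x))),
     SkTau = tau_transfer\<rparr>"

lemma transferred_skolem_simps [simp]:
  "SkFun transferred_skolem = skolem_functor"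
  "SkPres transferred_skolem = pres_transfer"
  "SkIncl transferred_skolem x = map_prod (image (FAr (model_transfer x)))
     (image (FAr (model_transfer x))) (SkIncl K (FOb \<phi> x))"
  "SkTau transferred_skolem = tau_transfer"
  "SkSig transferred_skolem x = til x"
  by (simp_all add: transferred_skolem_def SkSig_def)

context
  fixes x
  assumes x: "x \<in> Obj (Sig J)"
begin

interpretation T: inverse_functor_pair "Models I (skolem_sig x)" "Models J (til x)"
    "model_transfer x" "model_transfer_inv x"
  by unfold_locales (rule inverse_functors_model_transfer[OF x])

lemma skolemization_of_transferred_iff:
  assumes m: "m \<in> Obj (Models J x)"
  shows "skolemization_of J transferred_skolem x m' m \<longleftrightarrow> m' \<in> Obj (Models J (til x)) \<and>
    skolemization_of I K (FOb \<phi> x) (FOb (model_transfer_inv x) m') (FOb (\<beta> x) m)"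
proof (cases "m' \<in> Obj (Models J (til x))")
  case m': True
  interpret \<beta>: inverse_functor_pair "Models J x" "Models I (FOb \<phi> x)" "\<beta> x"
      "inv_functor (Models J x) (\<beta> x)"
    by unfold_locales (rule inverse_functors_\<beta>[OF x])
  have "reduct J (tau_transfer x) m' \<in> Obj (Models J x)"
    using J.red_hom[OF tau_transfer_hom[OF x]] m' by (rule is_functor.ob)
  then have "reduct J (tau_transfer x) m' = m
      \<longleftrightarrow> reduct I (SkTau K (FOb \<phi> x)) (FOb (model_transfer_inv x) m') = FOb (\<beta> x) m"
    by (simp add: \<beta>.FOb_eq_iff m flip: \<beta>_reduct_tau_transfer[OF x m'])
  then show ?thesis
    by (simp add: skolemization_of_def m' T.G.ob satisfies_all_pres_transfer[OF x m'])
qed (simp add: skolemization_of_def)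

lemma skolemization_of_transferred_SkMod:
  assumes m: "m \<in> Obj (Models J x)"
  shows "skolemization_of J transferred_skolem x (SkMod transferred_skolem x m) m"
proof -
  let ?n = "SkMod K (FOb \<phi> x) (FOb (\<beta> x) m)"
  have skolem_n: "skolemization_of I K (FOb \<phi> x) ?n (FOb (\<beta> x) m)"
    by (rule sk.skolemization_of_SkMod[OF sig.ob[OF x] \<beta>_ob[OF x m]])
  then have n: "?n \<in> Obj (Models I (skolem_sig x))"
    by (simp add: skolemization_of_def)
  have "SkMod transferred_skolem x m = FOb (model_transfer x) ?n"
    by (simp add: SkMod_def[of transferred_skolem] FOb_skolem_functor)
  then show ?thesis
    using skolem_n by (simp add: skolemization_of_transferred_iff[OF m] T.F.ob[OF n] T.GF_ob[OF n])
qed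

lemma inclusion_system_transferred_skolem:
  "inclusion_system (Models J (til x)) (SkIncl transferred_skolem x)"
proof -
  obtain U E where "SkIncl K (FOb \<phi> x) = (U, E)" by (rule prod.exhaust)
  then show ?thesis
    using sk.sk_inclusion_system[OF sig.ob[OF x]]
    by (simp add: T.inclusion_system_image)
qed

lemma inclusion_transferred_skolem:
  assumes incl: "inclusion (Models J (til x)) (SkIncl transferred_skolem x) m n"
  shows "inclusion (Models I (skolem_sig x)) (SkIncl K (FOb \<phi> x))
    (FOb (model_transfer_inv x) m) (FOb (model_transfer_inv x) n)"
proof -
  obtain U E where UE: "SkIncl K (FOb \<phi> x) = (U, E)" by (rule prod.exhaust)
  then have "U \<subseteq> Arr (Models I (skolem_sig x))"
    using sk.sk_inclusion_system[OF sig.ob[OF x]]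
    by (simp add: inclusion_system_def broad_subcategory_def)
  then show ?thesis
    using incl UE by (simp add: T.inclusion_image)
qed

end

theorem skolemization_transferred_skolem: "skolemization J transferred_skolem"
proof (intro skolemization.intro skolemization_axioms.intro J.is_institution_axioms)
  show "is_functor (grothendieck (Sig J) (Mod J)) (grothendieck (Pres J) (ModPres J))
      (SkFun transferred_skolem)"
    by (simp add: is_functor_skolem_functor)
next
  fix x assume x: "x \<in> Obj (Sig J)"
  show "SkPres transferred_skolem x \<in> Obj (Pres J)"
    by (simp add: pres_transfer_obj[OF x])
  show "SkTau transferred_skolem x \<in> hom_set (Sig J) x (SkSig transferred_skolem x)"
    by (simp add: tau_transfer_hom[OF x])
  show "inclusion_system (Models J (SkSig transferred_skolem x)) (SkIncl transferred_skolem x)"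
    using inclusion_system_transferred_skolem[OF x] by simp
  fix m assume m: "m \<in> Obj (Models J x)"
  show "fst (FOb (SkFun transferred_skolem) (x, m)) = SkPres transferred_skolem x"
    by (simp add: FOb_skolem_functor)
  show "reduct J (SkTau transferred_skolem x) (SkMod transferred_skolem x m) = m"
    using skolemization_of_transferred_SkMod[OF x m] by (simp add: skolemization_of_def)
  fix n m' n' assume n: "n \<in> Obj (Models J x)"
    and m': "skolemization_of J transferred_skolem x m' m"
    and n': "skolemization_of J transferred_skolem x n' n"
    and incl: "inclusion (Models J (SkSig transferred_skolem x)) (SkIncl transferred_skolem x)
      m' n'"
  have "skolemization_of I K (FOb \<phi> x) (FOb (model_transfer_inv x) m') (FOb (\<beta> x) m)"
    and "skolemization_of I K (FOb \<phi> x) (FOb (model_transfer_inv x) n') (FOb (\<beta> x) n)"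
    using m' n' by (simp_all add: skolemization_of_transferred_iff[OF x] m n)
  moreover have "inclusion (Models I (skolem_sig x)) (SkIncl K (FOb \<phi> x))
      (FOb (model_transfer_inv x) m') (FOb (model_transfer_inv x) n')"
    using incl inclusion_transferred_skolem[OF x] by simp
  ultimately have "model_star I (FOb \<phi> x) (FOb (\<beta> x) m) = model_star I (FOb \<phi> x) (FOb (\<beta> x) n)"
    by (rule sk.sk_elementary[OF sig.ob[OF x] \<beta>_ob[OF x m] \<beta>_ob[OF x n]])
  then show "model_star J x m = model_star J x n"
    by (rule model_star_reflect[OF x m n surj_\<alpha>[OF x]])
qed

end

theorem theorem14:
  fixes I :: "('o1, 'a1, 's1, 'm1, 'u1) institution"
    and J :: "('o2, 'a2, 's2, 'm2, 'u2) institution"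
    and K :: "('o1, 'a1, 's1, 'm1, 'u1) skolem"
    and \<phi> :: "('o2, 'a2, 'o1, 'a1) fnctr"
    and \<alpha> :: "'o2 \<Rightarrow> 's1 \<Rightarrow> 's2"
    and \<beta> :: "'o2 \<Rightarrow> ('m2, 'u2, 'm1, 'u1) fnctr"
    and til :: "'o2 \<Rightarrow> 'o2"
    and i :: "'o2 \<Rightarrow> 'a1"
  assumes "skolemization I K"
    and "institution_morphism J I \<phi> \<alpha> \<beta>"
    and "fully_faithful (Sig J) (Sig I) \<phi>"
    and "\<forall>\<Sigma>\<in>Obj (Sig J). til \<Sigma> \<in> Obj (Sig J) \<and>
           i \<Sigma> \<in> hom_set (Sig I) (FOb \<phi> (til \<Sigma>)) (SkSig K (FOb \<phi> \<Sigma>)) \<and>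
           iso_arrow (Sig I) (i \<Sigma>)"
    and "\<forall>\<Sigma>\<in>Obj (Sig J). iso_of_categories (Models J \<Sigma>) (Models I (FOb \<phi> \<Sigma>)) (\<beta> \<Sigma>)"
    and "\<forall>\<Sigma>\<in>Obj (Sig J). semantically_surjective J \<Sigma> (Sen I (FOb \<phi> \<Sigma>)) (\<alpha> \<Sigma>)"
  shows "\<exists>K' :: ('o2, 'a2, 's2, 'm2, 'u2) skolem.
    skolemization J K' \<and>
    (\<forall>\<Sigma>\<in>Obj (Sig J).
       SkSig K' \<Sigma> = til \<Sigma> \<and>
       (SkTau K' \<Sigma> \<in> hom_set (Sig J) \<Sigma> (til \<Sigma>) \<and>
        FAr \<phi> (SkTau K' \<Sigma>) =
          Cmp (Sig I) (inv_arrow (Sig I) (i \<Sigma>)) (SkTau K (FOb \<phi> \<Sigma>)) \<and>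
        (\<forall>t\<in>hom_set (Sig J) \<Sigma> (til \<Sigma>).
           FAr \<phi> t = Cmp (Sig I) (inv_arrow (Sig I) (i \<Sigma>)) (SkTau K (FOb \<phi> \<Sigma>))
             \<longrightarrow> t = SkTau K' \<Sigma>)) \<and>
       (\<forall>U E. SkIncl K (FOb \<phi> \<Sigma>) = (U, E) \<longrightarrow>
          (let F = functor_comp (inv_functor (Models J (til \<Sigma>)) (\<beta> (til \<Sigma>)))
                     (Red (Mod I) (i \<Sigma>))
           in SkIncl K' \<Sigma> = (FAr F ` U, FAr F ` E))))"
proof -
  interpret skolem_transfer I J K \<phi> \<alpha> \<beta> til i
    using assms by (simp add: skolem_transfer_def skolem_transfer_axioms_def)
  show ?thesis
    using skolemization_transferred_skolem tau_transfer_hom FAr_tau_transfer tau_transfer_unique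
    by (intro exI[of _ transferred_skolem]) (simp add: model_transfer_def Let_def)
qed

end
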